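(* Let $\mathcal{H}$ be a finite-dimensional Hilbert space, let $G_1,\ldots,G_J$ be Hermitian operators on $\mathcal{H}$, and for $\theta\in\mathbb{R}^J$ let $G(\theta)=\sum_{j=1}^J\theta_j G_j$ and $\rho(\theta)=e^{-G(\theta)}/\operatorname{Tr}[e^{-G(\theta)}]$. Then for each $j\in\{1,\ldots,J\}$ the symmetric logarithmic derivative operator of $\rho(\theta)$ with respect to $\theta_j$ is $$L^{(j)}(\theta)=-\Phi_\theta(G_j)+\operatorname{Tr}[G_j\rho(\theta)]\,I,$$ where $I$ is the identity operator on $\mathcal{H}$.
   Context: The "high-peak tent" probability density on $\mathbb{R}$ is $p(t)=\frac{2}{\pi}\ln|\coth(\pi t/2)|$. The quantum channel $\Phi_\theta$ is defined on operators $X$ on $\mathcal{H}$ by $\Phi_\theta(X)=\int_{\mathbb{R}}dt\,p(t)\,e^{-iG(\theta)t}Xe^{iG(\theta)t}$. With spectral decomposition $\rho(\theta)=\sum_k\lambda_k|k\rangle\langle k|$, the symmetric logarithmic derivative (SLD) operator is $L^{(j)}(\theta)=\sum_{k,\ell}\frac{2}{\lambda_k+\lambda_\ell}|k\rangle\langle k|\partial_j\rho(\theta)|\ell\rangle\langle\ell|$, where $\partial_j=\partial/\partial\theta_j$. *)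

theory Defs
  imports "HOL-Analysis.Analysis"
begin

text \<open>Operators on a finite-dimensional Hilbert space H = C^'n are complex 'n x 'n matrices.\<close>

type_synonym 'n cmat = "complex^'n^'n"

definition adjoint :: "'n::finite cmat \<Rightarrow> 'n cmat" where
  "adjoint A = (\<chi> i j. cnj (A$j$i))"

definition hermitian :: "'n::finite cmat \<Rightarrow> bool" where
  "hermitian A \<longleftrightarrow> adjoint A = A"

definition unitary :: "'n::finite cmat \<Rightarrow> bool" where
  "unitary U \<longleftrightarrow> U ** adjoint U = mat 1 \<and> adjoint U ** U = mat 1"

definition mtrace :: "'n::finite cmat \<Rightarrow> complex" where
  "mtrace A = (\<Sum>i\<in>UNIV. A$i$i)"

primrec mpow :: "'n::finite cmat \<Rightarrow> nat \<Rightarrow> 'n cmat" where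
  "mpow A 0 = mat 1"
| "mpow A (Suc k) = A ** mpow A k"

definition mexp :: "'n::finite cmat \<Rightarrow> 'n cmat" where
  "mexp A = (\<Sum>k. (1 / fact k) *\<^sub>R mpow A k)"

definition cscale :: "complex \<Rightarrow> 'n::finite cmat \<Rightarrow> 'n cmat" where
  "cscale c A = (\<chi> i j. c * A$i$j)"

definition Gen :: "('J::finite \<Rightarrow> 'n::finite cmat) \<Rightarrow> real^'J \<Rightarrow> 'n cmat" where
  "Gen G \<theta> = (\<Sum>j\<in>UNIV. (\<theta>$j) *\<^sub>R G j)"

definition gibbs :: "('J::finite \<Rightarrow> 'n::finite cmat) \<Rightarrow> real^'J \<Rightarrow> 'n cmat" where
  "gibbs G \<theta> = cscale (1 / mtrace (mexp (- Gen G \<theta>))) (mexp (- Gen G \<theta>))"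

definition coth :: "real \<Rightarrow> real" where
  "coth x = cosh x / sinh x"

definition tent :: "real \<Rightarrow> real" where
  "tent t = (2 / pi) * ln \<bar>coth (pi * t / 2)\<bar>"

definition Phi :: "('J::finite \<Rightarrow> 'n::finite cmat) \<Rightarrow> real^'J \<Rightarrow> 'n cmat \<Rightarrow> 'n cmat" where
  "Phi G \<theta> X = (LINT t|lborel. tent t *\<^sub>R
      (mexp (cscale (- \<i> * complex_of_real t) (Gen G \<theta>)) ** X **
       mexp (cscale (\<i> * complex_of_real t) (Gen G \<theta>))))"

definition pderiv_j :: "(real^'J::finite \<Rightarrow> 'n::finite cmat) \<Rightarrow> real^'J \<Rightarrow> 'J \<Rightarrow> 'n cmat" where
  "pderiv_j f \<theta> j = vector_derivative (\<lambda>s. f (\<theta> + s *\<^sub>R axis j 1)) (at 0)"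

definition colproj :: "'n::finite cmat \<Rightarrow> 'n \<Rightarrow> 'n cmat" where
  "colproj U k = (\<chi> a b. U$a$k * cnj (U$b$k))"

text \<open>SLD built from a spectral decomposition rho = sum_k lam_k |k><k| (columns of unitary U):
  L = sum_{k,l} 2/(lam_k+lam_l) |k><k| D |l><l|, with D = d rho.\<close>
definition sld :: "'n::finite cmat \<Rightarrow> ('n \<Rightarrow> real) \<Rightarrow> 'n cmat \<Rightarrow> 'n cmat" where
  "sld U lam D = (\<Sum>k\<in>UNIV. \<Sum>l\<in>UNIV.
      (2 / (lam k + lam l)) *\<^sub>R (colproj U k ** D ** colproj U l))"

end

theory Submission
  imports Defs "HOL-Real_Asymp.Real_Asymp"
begin

text \<open>
  The eigenprojections \<open>P\<^sub>k\<close> of \<open>\<rho>\<close> are eigenprojections of \<open>G(\<theta>)\<close> as well, with real eigenvalues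
  \<open>\<mu>\<^sub>k\<close>, and the identity can be checked block by block. Differentiating the exponential series gives
  \<open>P\<^sub>k (\<partial>\<^sub>j e\<^sup>-\<^sup>G) P\<^sub>l\<close> as \<open>- P\<^sub>k G\<^sub>j P\<^sub>l\<close> times the divided difference of \<open>exp\<close> at \<open>-\<mu>\<^sub>k\<close> and
  \<open>-\<mu>\<^sub>l\<close>; multiplied by \<open>2 / (exp (-\<mu>\<^sub>k) + exp (-\<mu>\<^sub>l))\<close> this is \<open>tanh (\<omega>/2) / (\<omega>/2)\<close> with
  \<open>\<omega> = \<mu>\<^sub>k - \<mu>\<^sub>l\<close>. The same factor appears in \<open>\<Phi>\<^sub>\<theta>(G\<^sub>j)\<close> as the Fourier transform of the tent density:
  expanding \<open>ln coth\<close> into exponentials and integrating termwise gives the partial fraction series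
  \<open>\<Sum> 8 / (((2k+1)\<pi>)\<^sup>2 + \<omega>\<^sup>2)\<close> of \<open>tanh (\<omega>/2) / (\<omega>/2)\<close>.
\<close>

section \<open>The Fourier transform of the tent density\<close>

lemma cosh_of_real: "cosh (complex_of_real x) = of_real (cosh x)"
  by (simp add: cosh_def scaleR_conv_of_real exp_of_real[symmetric])

lemma sin_i_of_real: "sin (\<i> * complex_of_real x) = \<i> * of_real (sinh x)"
proof -
  have "complex_of_real (sinh x) = sinh (of_real x)"
    by (simp add: sinh_def scaleR_conv_of_real exp_of_real[symmetric])
  thus ?thesis by (simp add: sinh_conv_sin)
qed

text \<open>Logarithmic derivative of the reflection formula for the Gamma function at \<open>1/2 + i y\<close>.\<close>

lemma sums_pi_tanh:
  fixes y :: real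
  shows "(\<lambda>k. 2 * y / ((real k + 1 / 2)\<^sup>2 + y\<^sup>2)) sums (pi * tanh (pi * y))"
proof -
  define p q where "p = 1 / 2 + \<i> * complex_of_real y" and "q = 1 / 2 - \<i> * complex_of_real y"
  have Re: "Re p = 1 / 2" "Re q = 1 / 2" by (auto simp: p_def q_def)
  have p: "p \<notin> \<int>\<^sub>\<le>\<^sub>0" and q: "q \<notin> \<int>\<^sub>\<le>\<^sub>0"
    using Re by (auto elim!: nonpos_Ints_cases)
  have nz: "p \<noteq> 0" "q \<noteq> 0" using Re by auto
  \<comment> \<open>Centred at \<open>1/2\<close>, the reflection formula has a cosine on the right.
    On the imaginary axis this is a \<open>cosh\<close>, which never vanishes, so dividing by it
    leaves \<open>tanh\<close>.\<close>
  have refl: "rGamma (1 / 2 + w) * rGamma (1 / 2 - w) = cos (of_real pi * w) / of_real pi" for w :: complex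
    using rGamma_reflection_complex[of "1 / 2 + w"]
    by (simp add: algebra_simps sin_add sin_of_real cos_of_real)
  let ?w = "\<i> * complex_of_real y"
  have "((\<lambda>w. rGamma (1 / 2 + w) * rGamma (1 / 2 - w)) has_field_derivative
          - rGamma p * Digamma p * rGamma q + rGamma q * Digamma q * rGamma p) (at ?w)"
    using p q unfolding p_def q_def
    by (auto intro!: derivative_eq_intros)
  moreover have "((\<lambda>w. rGamma (1 / 2 + w) * rGamma (1 / 2 - w)) has_field_derivative
          - sin (of_real pi * ?w)) (at ?w)"
    unfolding refl by (auto intro!: derivative_eq_intros)
  ultimately have "- rGamma p * Digamma p * rGamma q + rGamma q * Digamma q * rGamma p = - sin (of_real pi * ?w)"
    by (rule DERIV_unique)
  hence "rGamma p * rGamma q * (Digamma p - Digamma q) = sin (of_real pi * ?w)"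
    by (simp add: algebra_simps)
  also have "rGamma p * rGamma q = cos (of_real pi * ?w) / of_real pi"
    using refl[of ?w] by (simp add: p_def q_def)
  also have "of_real pi * ?w = \<i> * complex_of_real (pi * y)" by simp
  finally have "complex_of_real (cosh (pi * y)) / of_real pi * (Digamma p - Digamma q)
      = \<i> * complex_of_real (sinh (pi * y))"
    by (simp only: cosh_conv_cos[symmetric] sin_i_of_real cosh_of_real)
  hence dig: "Digamma p - Digamma q = \<i> * of_real (pi * tanh (pi * y))"
    using cosh_real_pos[of "pi * y"] by (simp add: tanh_def field_simps)
  \<comment> \<open>The terms \<open>inverse (of_nat (Suc k))\<close> and the Euler-Mascheroni
    constant are the same in both Digamma series and cancel in the difference.\<close>
  have "(\<lambda>k. (inverse (of_nat (Suc k)) - inverse (p + of_nat k)) - (inverse (of_nat (Suc k)) - inverse (q + of_nat k)))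
      sums (Digamma p - Digamma q)"
    using sums_diff[OF summable_sums[OF summable_Digamma[OF nz(1)]] summable_sums[OF summable_Digamma[OF nz(2)]]]
    by (simp add: Digamma_def)
  also have "(\<lambda>k. (inverse (of_nat (Suc k)) - inverse (p + of_nat k)) - (inverse (of_nat (Suc k)) - inverse (q + of_nat k)))
     = (\<lambda>k. \<i> * of_real (2 * y / ((real k + 1 / 2)\<^sup>2 + y\<^sup>2)))"
  proof
    fix k
    have "p + of_nat k \<noteq> 0" "q + of_nat k \<noteq> 0"
      using Re by (auto simp: complex_eq_iff)
    hence "inverse (q + of_nat k) - inverse (p + of_nat k)
        = ((p + of_nat k) - (q + of_nat k)) / ((p + of_nat k) * (q + of_nat k))"
      by (simp add: field_simps)
    also have "(p + of_nat k) * (q + of_nat k) = of_real ((real k + 1 / 2)\<^sup>2 + y\<^sup>2)"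
      by (simp add: p_def q_def complex_eq_iff power2_eq_square algebra_simps)
    also have "(p + of_nat k) - (q + of_nat k) = \<i> * of_real (2 * y)"
      by (simp add: p_def q_def)
    finally show "(inverse (of_nat (Suc k)) - inverse (p + of_nat k)) - (inverse (of_nat (Suc k)) - inverse (q + of_nat k))
       = \<i> * of_real (2 * y / ((real k + 1 / 2)\<^sup>2 + y\<^sup>2))"
      by simp
  qed
  finally have "(\<lambda>k. \<i> * of_real (2 * y / ((real k + 1 / 2)\<^sup>2 + y\<^sup>2))) sums (\<i> * of_real (pi * tanh (pi * y)))"
    unfolding dig .
  from sums_mult[OF this, of "-\<i>"]
  have "(\<lambda>k. complex_of_real (2 * y / ((real k + 1 / 2)\<^sup>2 + y\<^sup>2))) sums of_real (pi * tanh (pi * y))"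
    by (simp add: mult.assoc[symmetric])
  thus ?thesis by (simp only: sums_of_real_iff)
qed

text \<open>In the Basel series, grouped into consecutive pairs, the even denominators contribute a
  quarter of the total. This supplies the partial fraction series at \<open>w = 0\<close>, where
  dividing by \<open>w\<close> is impossible.\<close>

lemma sums_inverse_odd_squares: "(\<lambda>k. 1 / (2 * real k + 1)\<^sup>2) sums (pi\<^sup>2 / 8)"
proof -
  define f where "f = (\<lambda>n. 1 / (real n + 1)\<^sup>2)"
  have f: "f sums (pi\<^sup>2 / 6)" unfolding f_def using inverse_squares_sums by (simp add: add.commute)
  have "(\<lambda>n. \<Sum>i\<in>{n * 2..<n * 2 + 2}. f i) sums (pi\<^sup>2 / 6)"
    by (rule sums_group[OF f]) simp
  moreover have "(\<Sum>i\<in>{n * 2..<n * 2 + 2}. f i) = f (2 * n) + f (2 * n + 1)" for n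
    by (simp add: numeral_2_eq_2 mult.commute)
  moreover have "f (2 * n + 1) = f n / 4" for n
    by (simp add: f_def field_simps power2_eq_square)
  ultimately have "(\<lambda>n. f (2 * n) + f n / 4) sums (pi\<^sup>2 / 6)" by (simp only:)
  moreover have "(\<lambda>n. f n / 4) sums (pi\<^sup>2 / 6 / 4)" by (rule sums_divide[OF f])
  ultimately have "(\<lambda>n. (f (2 * n) + f n / 4) - f n / 4) sums (pi\<^sup>2 / 6 - pi\<^sup>2 / 6 / 4)"
    by (intro sums_diff) auto
  thus ?thesis by (simp add: f_def)
qed

text \<open>The value at 0 fills the removable singularity; there it is the total mass of the tent
  density.\<close>

definition tent_transform :: "real \<Rightarrow> real" where
  "tent_transform w = (if w = 0 then 1 else tanh (w / 2) / (w / 2))"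

text \<open>For \<open>w \<noteq> 0\<close> this is the series of \<open>sums_pi_tanh\<close> at
  \<open>y = w / (2 * pi)\<close>, scaled by \<open>2 / (w * pi)\<close>.\<close>

lemma sums_tent_transform:
  "(\<lambda>k. 8 / (((2 * real k + 1) * pi)\<^sup>2 + w\<^sup>2)) sums tent_transform w"
proof (cases "w = 0")
  case True
  have "(\<lambda>k. 8 / pi\<^sup>2 * (1 / (2 * real k + 1)\<^sup>2)) sums (8 / pi\<^sup>2 * (pi\<^sup>2 / 8))"
    by (intro sums_mult sums_inverse_odd_squares)
  thus ?thesis using True by (simp add: tent_transform_def power_mult_distrib mult.commute)
next
  case False
  have "(\<lambda>k. 2 / (w * pi) * (2 * (w / (2 * pi)) / ((real k + 1 / 2)\<^sup>2 + (w / (2 * pi))\<^sup>2))) sums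
      (2 / (w * pi) * (pi * tanh (pi * (w / (2 * pi)))))"
    by (intro sums_mult sums_pi_tanh)
  also have "2 / (w * pi) * (pi * tanh (pi * (w / (2 * pi)))) = tent_transform w"
    using False by (simp add: tent_transform_def)
  also have "(\<lambda>k. 2 / (w * pi) * (2 * (w / (2 * pi)) / ((real k + 1 / 2)\<^sup>2 + (w / (2 * pi))\<^sup>2)))
     = (\<lambda>k. 8 / (((2 * real k + 1) * pi)\<^sup>2 + w\<^sup>2))"
  proof
    fix k
    have "((real k + 1 / 2)\<^sup>2 + (w / (2 * pi))\<^sup>2) = (((2 * real k + 1) * pi)\<^sup>2 + w\<^sup>2) / (2 * pi)\<^sup>2"
      by (simp add: field_simps power2_eq_square)
    thus "2 / (w * pi) * (2 * (w / (2 * pi)) / ((real k + 1 / 2)\<^sup>2 + (w / (2 * pi))\<^sup>2))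
       = 8 / (((2 * real k + 1) * pi)\<^sup>2 + w\<^sup>2)"
      using False by (simp add: power2_eq_square)
  qed
  finally show ?thesis .
qed

section \<open>Termwise integration of the exponential expansion of the density\<close>

lemma has_bochner_integral_exp_Ioi:
  fixes c :: complex
  assumes "Re c < 0"
  shows "has_bochner_integral lborel (\<lambda>t. indicator {0<..} t *\<^sub>R exp (of_real t * c)) (- 1 / c)"
proof -
  have c: "c \<noteq> 0" using assms by auto
  have ei: "einterval 0 \<infinity> = {0<..}" by (auto simp: einterval_def zero_ereal_def)
  \<comment> \<open>Integrability is shown first for the norm \<open>exp (t * Re c)\<close>, which
    dominates the complex integrand; the value is then read off the antiderivative
    \<open>exp (of_real t * c) / c\<close>.\<close>
  have "set_integrable lborel (einterval 0 \<infinity>) (\<lambda>t. exp (t * Re c))"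
  proof (rule interval_integral_FTC_nonneg(1))
    show "((\<lambda>t. exp (t * Re c) / Re c) has_field_derivative exp (x * Re c)) (at x)" for x
      using assms by (auto intro!: derivative_eq_intros)
    show "(((\<lambda>t. exp (t * Re c) / Re c) \<circ> real_of_ereal) \<longlongrightarrow> 1 / Re c) (at_right 0)"
      unfolding zero_ereal_def ereal_tendsto_simps using assms
      by (auto intro!: tendsto_eq_intros)
    show "(((\<lambda>t. exp (t * Re c) / Re c) \<circ> real_of_ereal) \<longlongrightarrow> 0) (at_left \<infinity>)"
      unfolding ereal_tendsto_simps using assms
      by real_asymp
  qed auto
  hence si: "set_integrable lborel (einterval 0 \<infinity>) (\<lambda>t. exp (of_real t * c))"
    unfolding set_integrable_def
    by (rule Bochner_Integration.integrable_bound) (auto simp: einterval_def)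
  have "(LBINT t=0..\<infinity>. exp (of_real t * c)) = 0 - 1 / c"
  proof (rule interval_integral_FTC_integrable[OF _ _ _ si])
    show "((\<lambda>t. exp (of_real t * c) / c) has_vector_derivative exp (of_real x * c)) (at x)" for x
      using c by (auto intro!: derivative_eq_intros has_vector_derivative_real_field)
    show "(((\<lambda>t. exp (of_real t * c) / c) \<circ> real_of_ereal) \<longlongrightarrow> 1 / c) (at_right 0)"
      unfolding zero_ereal_def ereal_tendsto_simps using c
      by (auto intro!: tendsto_eq_intros)
    have "((\<lambda>t. exp (t * Re c)) \<longlongrightarrow> 0) at_top" using assms by real_asymp
    hence "((\<lambda>t. exp (of_real t * c)) \<longlongrightarrow> 0) at_top"
      by (subst tendsto_norm_zero_iff[symmetric]) simp
    hence "((\<lambda>t. exp (of_real t * c) / c) \<longlongrightarrow> 0) at_top"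
      by (rule tendsto_divide_zero)
    thus "(((\<lambda>t. exp (of_real t * c) / c) \<circ> real_of_ereal) \<longlongrightarrow> 0) (at_left \<infinity>)"
      unfolding ereal_tendsto_simps .
  qed auto
  thus ?thesis using si
    by (simp add: has_bochner_integral_iff interval_lebesgue_integral_def ei set_integrable_def
        set_lebesgue_integral_def)
qed

lemma has_bochner_integral_exp_abs:
  assumes "a > 0"
  shows "has_bochner_integral lborel (\<lambda>t. exp (of_real (- a * \<bar>t\<bar>) + \<i> * of_real (w * t)))
     (complex_of_real (2 * a / (a\<^sup>2 + w\<^sup>2)))"
proof -
  define c d where "c = Complex (-a) w" and "d = Complex (-a) (-w)"
  have cd: "Re c < 0" "Re d < 0" "c \<noteq> 0" "d \<noteq> 0" using assms by (auto simp: c_def d_def complex_eq_iff)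
  \<comment> \<open>The affine substitution with slope -1 reflects the half-line integral, which
    covers negative \<open>t\<close> with exponent \<open>d\<close>.\<close>
  have "has_bochner_integral lborel (\<lambda>t. indicator {0<..} (0 + (-1) * t) *\<^sub>R exp (of_real (0 + (-1) * t) * d)) ((- 1 / d) /\<^sub>R \<bar>-1\<bar>)"
    by (rule lborel_has_bochner_integral_real_affine_iff[THEN iffD1, OF _ has_bochner_integral_exp_Ioi[OF cd(2)]]) simp
  from has_bochner_integral_add[OF has_bochner_integral_exp_Ioi[OF cd(1)] this]
  have *: "has_bochner_integral lborel (\<lambda>t. indicator {0<..} t *\<^sub>R exp (of_real t * c) +
       indicator {0<..} (- t) *\<^sub>R exp (- of_real t * d)) (- 1 / c - 1 / d)"
    by simp
  have "has_bochner_integral lborel (\<lambda>t. exp (of_real (- a * \<bar>t\<bar>) + \<i> * of_real (w * t))) (- 1 / c - 1 / d)"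
  \<comment> \<open>Neither open half line contains 0, so the two integrands agree only almost
    everywhere.\<close>
  proof (rule has_bochner_integral_cong_AE[THEN iffD1, OF _ _ _ *])
    show "AE t in lborel. indicator {0<..} t *\<^sub>R exp (of_real t * c) +
       indicator {0<..} (- t) *\<^sub>R exp (- of_real t * d) = exp (of_real (- a * \<bar>t\<bar>) + \<i> * of_real (w * t))"
    proof (rule AE_mp[OF AE_lborel_singleton[of 0]], rule AE_I2, rule impI)
      fix t :: real assume "t \<noteq> 0"
      have "of_real t * c = of_real (- a * \<bar>t\<bar>) + \<i> * of_real (w * t)" if "t > 0"
        using that by (simp add: c_def complex_eq_iff)
      moreover have "- of_real t * d = of_real (- a * \<bar>t\<bar>) + \<i> * of_real (w * t)" if "t < 0"
        using that by (simp add: d_def complex_eq_iff)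
      ultimately show "indicator {0<..} t *\<^sub>R exp (of_real t * c) +
       indicator {0<..} (- t) *\<^sub>R exp (- of_real t * d) = exp (of_real (- a * \<bar>t\<bar>) + \<i> * of_real (w * t))"
        using \<open>t \<noteq> 0\<close> by (cases "t > 0") (auto simp: not_less)
    qed
  qed measurable
  moreover have "- 1 / c - 1 / d = of_real (2 * a / (a\<^sup>2 + w\<^sup>2))"
  proof -
    have "- 1 / c - 1 / d = - (c + d) / (c * d)" using cd by (simp add: field_simps)
    also have "c + d = - of_real (2 * a)" by (simp add: c_def d_def complex_eq_iff)
    also have "c * d = of_real (a\<^sup>2 + w\<^sup>2)" by (simp add: c_def d_def complex_eq_iff power2_eq_square)
    finally show ?thesis by simp
  qed
  ultimately show ?thesis by simp
qed

text \<open>With \<open>r = exp (- pi * \<bar>t\<bar>)\<close> the hyperbolic cotangent is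
  \<open>(1 + r) / (1 - r)\<close>, whose logarithm is twice the sum of the odd powers
  \<open>r ^ (2 * n + 1) / (2 * n + 1)\<close>. At \<open>t = 0\<close> the series diverges.\<close>

lemma sums_tent:
  assumes "t \<noteq> 0"
  shows "(\<lambda>k. 4 / pi / (2 * real k + 1) * exp (- ((2 * real k + 1) * pi) * \<bar>t\<bar>)) sums tent t"
proof -
  define r where "r = exp (- pi * \<bar>t\<bar>)"
  have r: "0 < r" "r < 1" using assms by (auto simp: r_def)
  define x where "x = (1 + r) / (1 - r)"
  have "coth (pi * \<bar>t\<bar> / 2) = x"
  proof -
    have "r = exp (- (pi * \<bar>t\<bar> / 2)) * exp (- (pi * \<bar>t\<bar> / 2))"
      by (simp add: r_def flip: exp_add)
    moreover define s where "s = exp (- (pi * \<bar>t\<bar> / 2))"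
    ultimately have rs: "r = s * s" by simp
    have s: "s > 0" by (simp add: s_def)
    have E: "exp (pi * \<bar>t\<bar> / 2) = 1 / s" by (simp add: s_def exp_minus field_simps)
    have "1 - s * s \<noteq> 0" using r rs by simp
    thus ?thesis unfolding coth_def cosh_field_def sinh_field_def x_def s_def[symmetric] E
      using s by (simp add: rs field_simps)
  qed
  moreover have "\<bar>coth (pi * t / 2)\<bar> = \<bar>coth (pi * \<bar>t\<bar> / 2)\<bar>"
    by (cases "t \<ge> 0") (auto simp: coth_def)
  ultimately have tent: "tent t = 2 / pi * ln x"
    using r by (simp add: tent_def x_def)
  have x: "x > 0" "(x - 1) / (x + 1) = r" using r by (auto simp: x_def divide_simps)
  have "(\<lambda>n. 2 / pi * (2 * r ^ (2 * n + 1) / of_nat (2 * n + 1))) sums (2 / pi * ln x)"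
    using sums_mult[OF ln_series_quadratic[OF x(1)]] unfolding x(2) .
  moreover have "r ^ (2 * n + 1) = exp (- ((2 * real n + 1) * pi) * \<bar>t\<bar>)" for n
    unfolding r_def exp_of_nat_mult[symmetric] by (simp add: algebra_simps)
  hence "2 / pi * (2 * r ^ (2 * n + 1) / of_nat (2 * n + 1))
      = 4 / pi / (2 * real n + 1) * exp (- ((2 * real n + 1) * pi) * \<bar>t\<bar>)" for n
    by simp
  ultimately show ?thesis unfolding tent by (simp only:)
qed

text \<open>The expansion of \<open>sums_tent\<close>, multiplied by the oscillating factor, is
  integrated term by term. The exchange is justified because the integrals of the norms are
  summable.\<close>

lemma has_bochner_integral_tent_exp:
  "has_bochner_integral lborel (\<lambda>t. of_real (tent t) * exp (\<i> * of_real (w * t)))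
     (complex_of_real (tent_transform w))"
proof -
  define a where "a = (\<lambda>k. (2 * real k + 1) * pi)"
  have a: "a k > 0" for k by (simp add: a_def add_nonneg_pos)
  define b where "b = (\<lambda>k. 4 / pi / (2 * real k + 1))"
  have b: "b k > 0" for k by (simp add: b_def add_nonneg_pos)
  define f where "f = (\<lambda>k t. complex_of_real (b k) * exp (of_real (- a k * \<bar>t\<bar>) + \<i> * of_real (w * t)))"
  have f: "has_bochner_integral lborel (f k) (of_real (8 / ((a k)\<^sup>2 + w\<^sup>2)))" for k
  proof -
    have "has_bochner_integral lborel (f k) (complex_of_real (b k) * of_real (2 * a k / ((a k)\<^sup>2 + w\<^sup>2)))"
      unfolding f_def by (intro has_bochner_integral_mult_right has_bochner_integral_exp_abs a)
    moreover have "b k * (2 * a k) = 8" 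
      by (simp add: a_def b_def divide_simps add_eq_0_iff_both_eq_0) 
    hence "b k * (2 * a k / ((a k)\<^sup>2 + w\<^sup>2)) = 8 / ((a k)\<^sup>2 + w\<^sup>2)"
      by (metis times_divide_eq_right)
    ultimately show ?thesis by (metis of_real_mult)
  qed
  have nf: "norm (f k t) = b k * exp (- a k * \<bar>t\<bar>)" for k t
    using b[of k] by (simp add: f_def norm_mult)
  have "has_bochner_integral lborel (\<lambda>t. norm (f k t)) (8 / (a k)\<^sup>2)" for k
  proof -
    \<comment> \<open>The norm of \<open>f k t\<close> is the same integrand at frequency 0, so the
      integral formula applies to it as well.\<close>
    have "has_bochner_integral lborel (\<lambda>t. complex_of_real (b k) * exp (of_real (- a k * \<bar>t\<bar>) + \<i> * of_real (0 * t))) (complex_of_real (b k) * of_real (2 * a k / ((a k)\<^sup>2 + 0\<^sup>2)))"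
      by (intro has_bochner_integral_mult_right has_bochner_integral_exp_abs a)
    hence "has_bochner_integral lborel (\<lambda>t. Re (complex_of_real (b k) * exp (of_real (- a k * \<bar>t\<bar>) + \<i> * of_real (0 * t)))) (Re (complex_of_real (b k) * of_real (2 * a k / ((a k)\<^sup>2 + 0\<^sup>2))))"
      by (rule has_bochner_integral_Re)
    moreover have "b k * (2 * a k) = 8" 
      by (simp add: a_def b_def divide_simps add_eq_0_iff_both_eq_0) 
    hence "Re (complex_of_real (b k) * of_real (2 * a k / ((a k)\<^sup>2 + 0\<^sup>2))) = 8 / (a k)\<^sup>2"
      by (metis Re_complex_of_real add_0_right of_real_mult power_zero_numeral times_divide_eq_right)
    moreover have "Re (complex_of_real (b k) * exp (of_real (- a k * \<bar>t\<bar>) + \<i> * of_real (0 * t))) = norm (f k t)" for t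
      unfolding nf by (simp add: Re_exp)
    ultimately show ?thesis by (simp only:)
  qed
  hence nint: "(\<integral>t. norm (f k t) \<partial>lborel) = 8 / (a k)\<^sup>2" for k
    by (simp add: has_bochner_integral_iff)
  have int: "integrable lborel (f k)" for k using f by (auto simp: has_bochner_integral_iff)
  have norms: "(\<lambda>k. norm (f k t)) sums tent t" if "t \<noteq> 0" for t
    using sums_tent[OF that] unfolding nf a_def b_def .
  have sm: "AE t in lborel. summable (\<lambda>k. norm (f k t))"
    by (rule AE_mp[OF AE_lborel_singleton[of 0]]) (use norms in \<open>auto simp: sums_iff\<close>)
  \<comment> \<open>These integrals are exactly the terms of the partial fraction series at
    \<open>w = 0\<close>.\<close>
  have sm2: "summable (\<lambda>k. \<integral>t. norm (f k t) \<partial>lborel)"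
    unfolding nint using sums_tent_transform[of 0] by (auto simp: a_def sums_iff)
  have sum_f: "(\<Sum>k. f k t) = of_real (tent t) * exp (\<i> * of_real (w * t))" if "t \<noteq> 0" for t
  proof -
    have "(\<lambda>k. of_real (b k * exp (- a k * \<bar>t\<bar>)) * exp (\<i> * of_real (w * t))) sums
        (of_real (tent t) * exp (\<i> * of_real (w * t)))"
      by (intro sums_mult2 sums_of_real) (use norms[OF that] nf in simp)
    moreover have "f k t = of_real (b k * exp (- a k * \<bar>t\<bar>)) * exp (\<i> * of_real (w * t))" for k
      unfolding f_def exp_add by (simp add: exp_of_real[symmetric])
    ultimately show ?thesis by (simp add: sums_iff)
  qed
  have val: "(\<Sum>k. integral\<^sup>L lborel (f k)) = of_real (tent_transform w)"
    using sums_of_real[OF sums_tent_transform[of w], where 'a=complex] f unfolding a_def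
    by (simp add: has_bochner_integral_iff sums_iff)
  have "has_bochner_integral lborel (\<lambda>t. \<Sum>k. f k t) (of_real (tent_transform w))"
    using integrable_suminf[OF int sm sm2] integral_suminf[OF int sm sm2] val
    by (simp add: has_bochner_integral_iff)
  thus ?thesis
  proof (rule has_bochner_integral_cong_AE[THEN iffD1, rotated -1])
    show "AE t in lborel. (\<Sum>k. f k t) = of_real (tent t) * exp (\<i> * of_real (w * t))"
      by (rule AE_mp[OF AE_lborel_singleton[of 0]]) (use sum_f in auto)
  qed (auto simp: f_def tent_def coth_def cosh_field_def sinh_field_def)
qed

section \<open>Complex matrices\<close>

text \<open>In finite dimension bilinearity already implies boundedness. The interpretation below
  then provides the distributive laws, limits of series and the product rule for matrix
  products.\<close>

lemma bounded_bilinear_matrix_mult: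
  "bounded_bilinear ((**) :: 'n::finite cmat \<Rightarrow> 'n cmat \<Rightarrow> 'n cmat)"
  unfolding bilinear_conv_bounded_bilinear[symmetric] bilinear_def linear_iff
  by (simp add: vec_eq_iff matrix_matrix_mult_def scaleR_sum_right algebra_simps sum.distrib)

interpretation matrix_mult: bounded_bilinear "(**) :: 'n::finite cmat \<Rightarrow> 'n cmat \<Rightarrow> 'n cmat"
  by (rule bounded_bilinear_matrix_mult)

lemma bounded_bilinear_cscale:
  "bounded_bilinear (cscale :: complex \<Rightarrow> 'n::finite cmat \<Rightarrow> 'n cmat)"
  unfolding bilinear_conv_bounded_bilinear[symmetric] bilinear_def linear_iff
  by (simp add: vec_eq_iff cscale_def algebra_simps)

interpretation cscale: bounded_bilinear "cscale :: complex \<Rightarrow> 'n::finite cmat \<Rightarrow> 'n cmat"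
  by (rule bounded_bilinear_cscale)

lemma cscale_mult_left: "cscale c A ** B = cscale c (A ** B)"
  by (simp add: vec_eq_iff cscale_def matrix_matrix_mult_def sum_distrib_left mult.assoc)

lemma cscale_mult_right: "A ** cscale c B = cscale c (A ** B)"
  by (simp add: vec_eq_iff cscale_def matrix_matrix_mult_def sum_distrib_left algebra_simps)

lemma cscale_cscale: "cscale a (cscale b A) = cscale (a * b) A"
  by (simp add: vec_eq_iff cscale_def mult.assoc)

lemma cscale_of_real: "cscale (of_real r) A = r *\<^sub>R A"
  by (simp add: vec_eq_iff cscale_def complex_eq_iff)

lemma cscale_1 [simp]: "cscale 1 A = A"
  by (simp add: vec_eq_iff cscale_def)

lemma mat_eq_cscale: "mat c = cscale c (mat 1)"
  by (simp add: vec_eq_iff cscale_def mat_def)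

lemma mat_mult_left: "mat c ** A = cscale c A"
  by (subst mat_eq_cscale) (simp add: cscale_mult_left)

lemma mat_mult_right: "A ** mat c = cscale c A"
  by (subst mat_eq_cscale) (simp add: cscale_mult_right)

lemma bounded_linear_mtrace: "bounded_linear (mtrace :: 'n::finite cmat \<Rightarrow> complex)"
  unfolding linear_conv_bounded_linear[symmetric] linear_iff
  by (simp add: mtrace_def sum.distrib scaleR_sum_right)

lemma mtrace_cscale: "mtrace (cscale c A) = c * mtrace A"
  by (simp add: mtrace_def cscale_def sum_distrib_left)

lemma mtrace_commute: "mtrace (A ** B) = mtrace (B ** A)"
  unfolding mtrace_def matrix_matrix_mult_def
  by (simp, subst sum.swap, simp add: mult.commute)

lemma bounded_linear_adjoint: "bounded_linear (adjoint :: 'n::finite cmat \<Rightarrow> 'n cmat)"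
  unfolding linear_conv_bounded_linear[symmetric] linear_iff
  by (simp add: adjoint_def vec_eq_iff)

lemma adjoint_mult: "adjoint (A ** B) = adjoint B ** adjoint A"
  by (simp add: adjoint_def vec_eq_iff matrix_matrix_mult_def mult.commute)

lemma adjoint_adjoint [simp]: "adjoint (adjoint A) = A"
  by (simp add: adjoint_def vec_eq_iff)

lemma adjoint_mat_1 [simp]: "adjoint (mat 1) = mat 1"
  by (auto simp: adjoint_def vec_eq_iff mat_def)

lemma adjoint_cscale: "adjoint (cscale c A) = cscale (cnj c) (adjoint A)"
  by (simp add: adjoint_def vec_eq_iff cscale_def)

lemma bounded_linear_entry: "bounded_linear (\<lambda>A :: 'n::finite cmat. A $ i $ j)"
  by (intro bounded_linear_compose[OF bounded_linear_vec_nth] bounded_linear_vec_nth)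

text \<open>The squared Frobenius norm; without the root it is itself a trace.\<close>

definition frob :: "'n::finite cmat \<Rightarrow> real" where
  "frob A = (\<Sum>i\<in>UNIV. \<Sum>j\<in>UNIV. (cmod (A $ i $ j))\<^sup>2)"

text \<open>All positivity arguments below rest on this: a trace of the form
  \<open>mtrace (adjoint A ** A)\<close> is a sum of squares and vanishes only for
  \<open>A = 0\<close>.\<close>

lemma mtrace_adjoint_mult: "mtrace (adjoint A ** A) = of_real (frob A)"
proof -
  have "mtrace (adjoint A ** A) = (\<Sum>j\<in>UNIV. \<Sum>i\<in>UNIV. of_real ((cmod (A $ i $ j))\<^sup>2))"
    by (simp only: mtrace_def adjoint_def matrix_matrix_mult_def vec_lambda_beta
        complex_norm_square mult.commute)
  thus ?thesis unfolding frob_def by (subst sum.swap) simp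
qed

lemma frob_nonneg: "frob A \<ge> 0"
  by (simp add: frob_def sum_nonneg)

lemma frob_eq_0_iff: "frob A = 0 \<longleftrightarrow> A = 0"
  by (simp add: frob_def sum_nonneg_eq_0_iff sum_nonneg vec_eq_iff)

section \<open>Rank-one projections onto the columns of a unitary matrix\<close>

lemma unitary_columns:
  assumes "unitary U"
  shows "(\<Sum>c\<in>UNIV. cnj (U $ c $ k) * U $ c $ l) = (if k = l then 1 else 0)"
proof -
  have "(adjoint U ** U) $ k $ l = mat 1 $ k $ l"
    using assms by (simp add: unitary_def)
  thus ?thesis by (simp add: matrix_matrix_mult_def adjoint_def mat_def)
qed

lemma colproj_mult:
  assumes "unitary U"
  shows "colproj U k ** colproj U l = (if k = l then colproj U k else 0)"
proof -
  have "(colproj U k ** colproj U l) $ a $ b =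
      U $ a $ k * (\<Sum>c\<in>UNIV. cnj (U $ c $ k) * U $ c $ l) * cnj (U $ b $ l)" for a b
    by (simp add: matrix_matrix_mult_def colproj_def sum_distrib_left sum_distrib_right mult.assoc)
  thus ?thesis by (simp add: unitary_columns[OF assms] vec_eq_iff colproj_def)
qed

lemma sum_colproj:
  assumes "unitary U"
  shows "(\<Sum>k\<in>UNIV. colproj U k) = mat 1"
proof -
  have "(\<Sum>k\<in>UNIV. colproj U k) = U ** adjoint U"
    by (simp add: vec_eq_iff colproj_def matrix_matrix_mult_def adjoint_def)
  thus ?thesis using assms by (simp add: unitary_def)
qed

lemma hermitian_colproj: "hermitian (colproj U k)"
  by (simp add: hermitian_def adjoint_def colproj_def vec_eq_iff)

lemma colproj_nonzero:
  assumes "unitary U"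
  shows "colproj U k \<noteq> 0"
proof
  assume 0: "colproj U k = 0"
  have "(\<Sum>c\<in>UNIV. cnj (U $ c $ k) * U $ c $ k) = 1"
    by (simp add: unitary_columns[OF assms])
  moreover have "cnj (U $ c $ k) * U $ c $ k = 0" for c
    using arg_cong[OF 0, of "\<lambda>M. M $ c $ c"] by (simp add: colproj_def)
  ultimately show False by simp
qed

text \<open>The resolution of the identity is inserted on both sides of \<open>X\<close>. It expands
  the integrand of \<open>Phi\<close> into blocks.\<close>

lemma block_decomposition:
  assumes "unitary U"
  shows "X = (\<Sum>k\<in>UNIV. \<Sum>l\<in>UNIV. colproj U k ** X ** colproj U l)"
proof -
  have "X = (\<Sum>k\<in>UNIV. colproj U k) ** X ** (\<Sum>l\<in>UNIV. colproj U l)"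
    by (simp add: sum_colproj[OF assms])
  also have "\<dots> = (\<Sum>k\<in>UNIV. \<Sum>l\<in>UNIV. colproj U k ** X ** colproj U l)"
    unfolding matrix_mult.sum_left matrix_mult.sum_right by (rule sum.swap)
  finally show ?thesis .
qed

text \<open>Take adjoints; the eigenvalue is real and therefore unchanged.\<close>

lemma hermitian_eigen_left:
  assumes "hermitian A" "hermitian P" "A ** P = r *\<^sub>R P"
  shows "P ** A = r *\<^sub>R P"
  using arg_cong[OF assms(3), of adjoint] assms(1,2)
  by (simp add: adjoint_mult hermitian_def linear_simps(5)[OF bounded_linear_adjoint])

section \<open>The matrix exponential\<close>

lemma mpow_commute:
  assumes "A ** B = B ** A"
  shows "mpow A k ** B = B ** mpow A k"
proof (induction k)
  case (Suc k)
  have "mpow A (Suc k) ** B = A ** (B ** mpow A k)"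
    by (simp only: mpow.simps matrix_mul_assoc[symmetric] Suc)
  also have "\<dots> = B ** mpow A (Suc k)"
    by (simp only: mpow.simps matrix_mul_assoc assms)
  finally show ?case .
qed simp

lemma mpow_add: "mpow A (m + n) = mpow A m ** mpow A n"
  by (induction m) (auto simp: matrix_mul_assoc)

lemma adjoint_mpow: "adjoint (mpow A k) = mpow (adjoint A) k"
  by (induction k) (simp_all add: adjoint_mult mpow_commute[OF refl])

lemma mpow_uminus: "mpow (- A) k = (-1) ^ k *\<^sub>R mpow A k"
  by (induction k) (auto simp: matrix_mult.minus_left matrix_mult.scaleR_right)

text \<open>\<open>K\<close> bounds the bilinear product. Both estimates are delivered with the same
  \<open>K\<close>, valid for all matrices at once, so that the later bound on \<open>dpow\<close>
  is uniform.\<close>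

lemma norm_mpow_le:
  obtains K where "K > 0"
    "\<And>(A :: 'n::finite cmat) (B :: 'n cmat). norm (A ** B) \<le> K * norm A * norm B"
    "\<And>(A :: 'n cmat) k. norm (mpow A k) \<le> norm (mat 1 :: 'n cmat) * (K * norm A) ^ k"
proof -
  from bounded_bilinear.pos_bounded[OF bounded_bilinear_matrix_mult[where 'n='n]] obtain K where K: "K > 0"
    "\<forall>(A :: 'n cmat) (B :: 'n cmat). norm (A ** B) \<le> norm A * norm B * K" by blast
  have 2: "norm (A ** B) \<le> K * norm A * norm B" for A B :: "'n cmat"
    using K(2)[rule_format, of A B] by (simp add: mult_ac)
  have "norm (mpow A k) \<le> norm (mat 1 :: 'n cmat) * (K * norm A) ^ k" for A :: "'n cmat" and k
  proof (induction k)
    case (Suc k)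
    have "norm (mpow A (Suc k)) \<le> K * norm A * norm (mpow A k)" using 2 by simp
    also have "\<dots> \<le> K * norm A * (norm (mat 1 :: 'n cmat) * (K * norm A) ^ k)"
      using K(1) by (intro mult_left_mono Suc) auto
    finally show ?case by (simp add: mult_ac)
  qed simp
  with K(1) 2 show ?thesis by (rule that)
qed

lemma summable_power_over_fact: "summable (\<lambda>k. c * (x ^ k / fact k) :: real)"
  using summable_exp[of x] by (intro summable_mult) (simp add: field_simps)

lemma summable_norm_mexp: "summable (\<lambda>k. norm ((1 / fact k) *\<^sub>R mpow (A :: 'n::finite cmat) k))"
proof -
  obtain K where "\<And>k. norm (mpow A k) \<le> norm (mat 1 :: 'n cmat) * (K * norm A) ^ k"
    using norm_mpow_le[where 'n='n] by metis
  hence "norm (norm ((1 / fact k) *\<^sub>R mpow A k)) \<le> norm (mat 1 :: 'n cmat) * ((K * norm A) ^ k / fact k)" for k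
    by (simp add: divide_right_mono)
  thus ?thesis by (rule summable_comparison_test'[OF summable_power_over_fact])
qed

lemma sums_mexp: "(\<lambda>k. (1 / fact k) *\<^sub>R mpow A k) sums mexp A"
  unfolding mexp_def by (intro summable_sums summable_norm_cancel[OF summable_norm_mexp])

text \<open>The binomial theorem for commuting matrices, normalised by factorials. Multiplying by
  \<open>A + B\<close> gives the summand of index \<open>i\<close> the weights \<open>i\<close> and
  \<open>Suc n - i\<close>, which add up to \<open>Suc n\<close>.\<close>

lemma mexp_term_add:
  fixes A B :: "'n::finite cmat"
  defines "S \<equiv> \<lambda>(A :: 'n cmat) k. (1 / fact k) *\<^sub>R mpow A k"
  assumes comm: "A ** B = B ** A"
  shows "S (A + B) n = (\<Sum>i\<le>n. S A i ** S B (n - i))"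
proof (induct n)
  case 0
  show ?case by (simp add: S_def)
next
  case (Suc n)
  have times_S: "X ** S X n = real (Suc n) *\<^sub>R S X (Suc n)" for X n
    by (simp add: S_def matrix_mult.scaleR_right del: of_nat_Suc)
  have S_comm: "B ** (S A i ** X) = S A i ** (B ** X)" for i X
    by (simp add: S_def matrix_mult.scaleR_right matrix_mult.scaleR_left matrix_mul_assoc mpow_commute[OF comm])
  have "real (Suc n) *\<^sub>R S (A + B) (Suc n) = (A + B) ** (\<Sum>i\<le>n. S A i ** S B (n - i))"
    by (metis Suc.hyps times_S)
  also have "\<dots> = (\<Sum>i\<le>n. A ** S A i ** S B (n - i)) + (\<Sum>i\<le>n. S A i ** (B ** S B (n - i)))"
    by (simp only: matrix_mult.add_left matrix_mult.sum_right S_comm) (simp add: matrix_mul_assoc sum.distrib)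
  also have "\<dots> = (\<Sum>i\<le>n. real (Suc i) *\<^sub>R (S A (Suc i) ** S B (n - i)))
                + (\<Sum>i\<le>n. real (Suc n - i) *\<^sub>R (S A i ** S B (Suc n - i)))"
    by (simp add: times_S Suc_diff_le matrix_mult.scaleR_left matrix_mult.scaleR_right)
  \<comment> \<open>Both sums are extended to \<open>Suc n\<close> by a term of weight 0: index 0
    after the shift here, index \<open>Suc n\<close> in the next step.\<close>
  also have "(\<Sum>i\<le>n. real (Suc i) *\<^sub>R (S A (Suc i) ** S B (n - i)))
           = (\<Sum>i\<le>Suc n. real i *\<^sub>R (S A i ** S B (Suc n - i)))"
    by (subst sum.atMost_Suc_shift) simp
  also have "(\<Sum>i\<le>n. real (Suc n - i) *\<^sub>R (S A i ** S B (Suc n - i)))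
           = (\<Sum>i\<le>Suc n. real (Suc n - i) *\<^sub>R (S A i ** S B (Suc n - i)))"
    by simp
  also have "(\<Sum>i\<le>Suc n. real i *\<^sub>R (S A i ** S B (Suc n - i)))
           + (\<Sum>i\<le>Suc n. real (Suc n - i) *\<^sub>R (S A i ** S B (Suc n - i)))
           = (\<Sum>i\<le>Suc n. real (Suc n) *\<^sub>R (S A i ** S B (Suc n - i)))"
    by (simp flip: sum.distrib scaleR_add_left of_nat_add)
  also have "\<dots> = real (Suc n) *\<^sub>R (\<Sum>i\<le>Suc n. S A i ** S B (Suc n - i))"
    by (simp only: scaleR_right.sum)
  finally show ?case
    by (simp del: sum.cl_ivl_Suc)
qed

text \<open>A Cauchy product, formed entry by entry, where the factors are absolutely convergent
  complex series.\<close>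

lemma mexp_add:
  fixes A B :: "'n::finite cmat"
  assumes "A ** B = B ** A"
  shows "mexp (A + B) = mexp A ** mexp B"
proof -
  define S where "S = (\<lambda>(A :: 'n cmat) k. (1 / fact k) *\<^sub>R mpow A k)"
  have sums: "S A sums mexp A" for A unfolding S_def by (rule sums_mexp)
  have entry: "(\<lambda>k. S A k $ i $ j) sums (mexp A $ i $ j)" for A i j
    by (rule bounded_linear.sums[OF bounded_linear_entry sums])
  have summable: "summable (\<lambda>k. norm (S A k $ i $ j))" for A i j
  proof (rule summable_comparison_test')
    show "summable (\<lambda>k. norm (S A k))" unfolding S_def by (rule summable_norm_mexp)
    show "norm (norm (S A k $ i $ j)) \<le> norm (S A k)" for k
      by (simp add: order_trans[OF Finite_Cartesian_Product.norm_nth_le Finite_Cartesian_Product.norm_nth_le])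
  qed
  have "mexp (A + B) $ i $ l = (mexp A ** mexp B) $ i $ l" for i l
  proof (rule sums_unique2)
    show "(\<lambda>k. S (A + B) k $ i $ l) sums (mexp (A + B) $ i $ l)" by (rule entry)
    have "(\<lambda>k. \<Sum>j\<in>UNIV. \<Sum>m\<le>k. S A m $ i $ j * S B (k - m) $ j $ l) sums
        (\<Sum>j\<in>UNIV. mexp A $ i $ j * mexp B $ j $ l)"
      using Cauchy_product_sums[OF summable summable] entry
      by (intro sums_sum) (simp add: sums_iff)
    also have "(\<lambda>k. \<Sum>j\<in>UNIV. \<Sum>m\<le>k. S A m $ i $ j * S B (k - m) $ j $ l) = (\<lambda>k. S (A + B) k $ i $ l)"
    proof
      fix k
      have "S (A + B) k $ i $ l = (\<Sum>m\<le>k. (S A m ** S B (k - m)) $ i $ l)"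
        using mexp_term_add[OF assms, of k] unfolding S_def by (simp only: sum_component)
      also have "\<dots> = (\<Sum>j\<in>UNIV. \<Sum>m\<le>k. S A m $ i $ j * S B (k - m) $ j $ l)"
        by (subst sum.swap) (simp add: matrix_matrix_mult_def)
      finally show "(\<Sum>j\<in>UNIV. \<Sum>m\<le>k. S A m $ i $ j * S B (k - m) $ j $ l) = S (A + B) k $ i $ l" ..
    qed
    finally show "(\<lambda>k. S (A + B) k $ i $ l) sums ((mexp A ** mexp B) $ i $ l)"
      by (simp add: matrix_matrix_mult_def)
  qed
  thus ?thesis by (simp add: vec_eq_iff)
qed

text \<open>Each power of \<open>A\<close> acts on \<open>P\<close> as \<open>a ^ k\<close>, and
  right multiplication by \<open>P\<close> passes through the series. \<open>P\<close> is arbitrary,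
  so \<open>mat 1\<close> is also a possible choice.\<close>

lemma mexp_eigen_right:
  assumes "A ** P = cscale a P"
  shows "mexp A ** P = cscale (exp a) P"
proof (rule sums_unique2)
  show "(\<lambda>k. ((1 / fact k) *\<^sub>R mpow A k) ** P) sums (mexp A ** P)"
    by (rule bounded_linear.sums[OF matrix_mult.bounded_linear_left sums_mexp])
  have "mpow A k ** P = cscale (a ^ k) P" for k
    by (induction k) (auto simp: matrix_mul_assoc[symmetric] cscale_mult_right assms cscale_cscale mult.commute)
  hence "(\<lambda>k. ((1 / fact k) *\<^sub>R mpow A k) ** P) = (\<lambda>k. cscale (a ^ k /\<^sub>R fact k) P)"
    by (simp add: matrix_mult.scaleR_left cscale.scaleR_left divide_inverse)
  moreover have "(\<lambda>k. cscale (a ^ k /\<^sub>R fact k) P) sums cscale (exp a) P"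
    by (rule bounded_linear.sums[OF cscale.bounded_linear_left exp_converges])
  ultimately show "(\<lambda>k. ((1 / fact k) *\<^sub>R mpow A k) ** P) sums cscale (exp a) P" by simp
qed

lemma mexp_0 [simp]: "mexp 0 = mat 1"
  using mexp_eigen_right[of 0 "mat 1" 0] by (simp add: cscale.zero_left)

lemma mexp_mult_mexp_uminus: "mexp A ** mexp (- A) = mat 1"
  using mexp_add[of A "- A"] by (simp add: matrix_mult.minus_left matrix_mult.minus_right)

lemma adjoint_mexp: "adjoint (mexp A) = mexp (adjoint A)"
proof (rule sums_unique2)
  show "(\<lambda>k. adjoint ((1 / fact k) *\<^sub>R mpow A k)) sums adjoint (mexp A)"
    by (rule bounded_linear.sums[OF bounded_linear_adjoint sums_mexp])
  have "adjoint ((1 / fact k) *\<^sub>R mpow A k) = (1 / fact k) *\<^sub>R mpow (adjoint A) k" for k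
    by (simp add: linear_simps(5)[OF bounded_linear_adjoint] adjoint_mpow)
  thus "(\<lambda>k. adjoint ((1 / fact k) *\<^sub>R mpow A k)) sums mexp (adjoint A)"
    using sums_mexp[of "adjoint A"] by simp
qed

lemma mexp_eigen_left:
  assumes "P ** A = cscale a P"
  shows "P ** mexp A = cscale (exp a) P"
proof -
  have "adjoint A ** adjoint P = cscale (cnj a) (adjoint P)"
    using arg_cong[OF assms, of adjoint] by (simp add: adjoint_mult adjoint_cscale)
  from arg_cong[OF mexp_eigen_right[OF this], of adjoint] show ?thesis
    by (simp add: adjoint_mult adjoint_cscale exp_cnj adjoint_mexp)
qed

text \<open>If \<open>exp B\<close> fixes \<open>P\<close> then so does \<open>cosh B\<close>. Only even powers of \<open>B\<close> occur in \<open>cosh\<close>, and each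
  contributes a squared Frobenius norm, so all terms but the constant one vanish. This replaces the
  spectral theorem for Hermitian matrices.\<close>

lemma hermitian_mexp_fix:
  fixes B P :: "'n::finite cmat"
  assumes B: "hermitian B" and P: "hermitian P" and pfix: "mexp B ** P = P"
  shows "B ** P = 0"
proof -
  have fix': "mexp (- B) ** P = P"
    using arg_cong[OF pfix, of "\<lambda>X. mexp (- B) ** X"] mexp_mult_mexp_uminus[of "- B"]
    by (simp add: matrix_mul_assoc)
  define T where "T = (\<lambda>X :: 'n cmat. Re (mtrace (P ** (X ** P))))"
  have T: "bounded_linear T" unfolding T_def
    by (intro bounded_linear_compose[OF bounded_linear_Re] bounded_linear_compose[OF bounded_linear_mtrace]
        bounded_linear_compose[OF matrix_mult.bounded_linear_right] matrix_mult.bounded_linear_left)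
  have Tscale: "T (r *\<^sub>R X) = r * T X" for r X
    using linear_simps(5)[OF T] by simp
  \<comment> \<open>Up to sign conventions of the series, \<open>g\<close> lists the terms of
    \<open>2 * cosh B\<close> as seen by \<open>T\<close>: odd ones cancel, even ones are squared
    norms.\<close>
  define g where "g = (\<lambda>k. (1 + (-1) ^ k) / fact k * T (mpow B k))"
  have "(\<lambda>k. T ((1 / fact k) *\<^sub>R mpow B k) + T ((1 / fact k) *\<^sub>R mpow (- B) k)) sums (T (mexp B) + T (mexp (- B)))"
    by (intro sums_add bounded_linear.sums[OF T] sums_mexp)
  also have "(\<lambda>k. T ((1 / fact k) *\<^sub>R mpow B k) + T ((1 / fact k) *\<^sub>R mpow (- B) k)) = g"
    by (simp add: g_def Tscale mpow_uminus fun_eq_iff add_divide_distrib ring_distribs)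
  \<comment> \<open>Both exponentials fix \<open>P\<close>, so the whole sum equals its constant
    term.\<close>
  also have "T (mexp B) + T (mexp (- B)) = g 0"
    by (simp add: g_def T_def pfix fix')
  finally have g: "g sums g 0" .
  have T_even: "T (mpow B (m + m)) = frob (mpow B m ** P)" for m
  proof -
    have "P ** (mpow B (m + m) ** P) = adjoint (mpow B m ** P) ** (mpow B m ** P)"
      using B P by (simp add: adjoint_mult adjoint_mpow hermitian_def mpow_add matrix_mul_assoc)
    thus ?thesis by (simp add: T_def mtrace_adjoint_mult)
  qed
  have g_nonneg: "g k \<ge> 0" for k
  proof (cases "even k")
    case True
    then obtain m where "k = m + m" by (metis evenE mult_2)
    thus ?thesis using T_even[of m] frob_nonneg[of "mpow B m ** P"] by (simp add: g_def)
  qed (simp add: g_def)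
  \<comment> \<open>The nonnegative series already sums to \<open>g 0\<close>, which leaves no room
    for \<open>g 2\<close>; the coefficient of \<open>g 2\<close> is
    \<open>2 / fact 2 = 1\<close>.\<close>
  have "sum g {0, 2} \<le> suminf g"
    using g g_nonneg by (intro sum_le_suminf) (auto simp: sums_iff)
  hence "g 2 \<le> 0" using g by (simp add: sums_iff)
  moreover have "g 2 = frob (B ** P)" using T_even[of 1] by (simp add: g_def numeral_2_eq_2)
  ultimately have "frob (B ** P) = 0" using frob_nonneg[of "B ** P"] by simp
  thus ?thesis by (simp add: frob_eq_0_iff)
qed

text \<open>Subtracting \<open>ln c\<close> times the identity keeps the matrix Hermitian and turns
  the eigenvalue \<open>c\<close> of the exponential into 1, which is the case of
  \<open>hermitian_mexp_fix\<close>.\<close>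

lemma hermitian_mexp_eigen:
  assumes H: "hermitian H" and P: "hermitian P" and c: "c > 0" and eig: "mexp H ** P = c *\<^sub>R P"
  shows "H ** P = ln c *\<^sub>R P"
proof -
  define B where "B = H + mat (of_real (- ln c))"
  have "mexp B = mexp H ** mexp (mat (of_real (- ln c)))"
    unfolding B_def by (rule mexp_add) (simp only: mat_mult_left mat_mult_right)
  hence "mexp B ** P = mexp H ** cscale (exp (of_real (- ln c))) P"
    by (simp only: matrix_mul_assoc[symmetric] mexp_eigen_right[OF mat_mult_left])
  also have "exp (of_real (- ln c)) = complex_of_real (1 / c)"
    unfolding exp_of_real using c by (simp add: exp_minus divide_inverse)
  also have "mexp H ** cscale (complex_of_real (1 / c)) P = P"
    unfolding cscale_of_real matrix_mult.scaleR_right eig using c by simp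
  finally have pfix: "mexp B ** P = P" .
  have "hermitian B"
    using H by (auto simp: B_def hermitian_def adjoint_def mat_def vec_eq_iff)
  from hermitian_mexp_fix[OF this P pfix] show ?thesis
    unfolding B_def matrix_mult.add_left mat_mult_left cscale_of_real by (simp add: add_eq_0_iff)
qed

section \<open>Differentiating the matrix exponential\<close>

text \<open>Directional derivatives of the \<open>k\<close>-th power and of the exponential at \<open>A\<close> in direction \<open>B\<close>.\<close>

primrec dpow :: "'n::finite cmat \<Rightarrow> 'n cmat \<Rightarrow> nat \<Rightarrow> 'n cmat" where
  "dpow A B 0 = 0"
| "dpow A B (Suc k) = B ** mpow A k + A ** dpow A B k"

definition dexp :: "'n::finite cmat \<Rightarrow> 'n cmat \<Rightarrow> 'n cmat" where
  "dexp A B = (\<Sum>k. (1 / fact k) *\<^sub>R dpow A B k)"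

lemma has_vector_derivative_mpow:
  "((\<lambda>s. mpow (A + s *\<^sub>R B) k) has_vector_derivative dpow (A + s *\<^sub>R B) B k) (at s within S)"
proof (induction k)
  case (Suc k)
  have "((\<lambda>s. A + s *\<^sub>R B) has_vector_derivative B) (at s within S)"
    by (auto intro!: derivative_eq_intros simp: has_vector_derivative_def)
  from matrix_mult.has_vector_derivative[OF this Suc] show ?case
    by (simp add: add.commute)
qed simp

text \<open>The product rule yields \<open>k\<close> summands, each of order
  \<open>(K * R) ^ k\<close>, and \<open>k \<le> 2 ^ k\<close> absorbs their number. Only
  \<open>R\<close> enters the bound, so it is uniform in \<open>A\<close> and
  \<open>B\<close>.\<close>

lemma norm_dpow_le:
  obtains K where
    "\<And>(A :: 'n::finite cmat) B R k. norm A \<le> R \<Longrightarrow> norm B \<le> R \<Longrightarrow>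
       norm (dpow A B k) \<le> norm (mat 1 :: 'n cmat) * (2 * (K * R)) ^ k"
proof -
  obtain K where K: "K > 0" "\<And>(A :: 'n cmat) (B :: 'n cmat). norm (A ** B) \<le> K * norm A * norm B"
    "\<And>(A :: 'n cmat) k. norm (mpow A k) \<le> norm (mat 1 :: 'n cmat) * (K * norm A) ^ k"
    using norm_mpow_le[where 'n='n] by metis
  have "norm (dpow A B k) \<le> norm (mat 1 :: 'n cmat) * (2 * (K * R)) ^ k"
    if AB: "norm A \<le> R" "norm B \<le> R" for A B :: "'n cmat" and R k
  proof -
    have R: "R \<ge> 0" using AB norm_ge_zero order_trans by blast
    let ?C = "norm (mat 1 :: 'n cmat)"
    have "norm (dpow A B k) \<le> ?C * (real k * (K * R) ^ k)"
    proof (induction k)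
      case (Suc k)
      have "norm (dpow A B (Suc k)) \<le> norm (B ** mpow A k) + norm (A ** dpow A B k)"
        by (simp add: norm_triangle_ineq)
      also have "\<dots> \<le> K * norm B * norm (mpow A k) + K * norm A * norm (dpow A B k)"
        by (rule add_mono[OF K(2) K(2)])
      also have "\<dots> \<le> K * R * (?C * (K * R) ^ k) + K * R * (?C * (real k * (K * R) ^ k))"
      proof (intro add_mono mult_mono Suc AB)
        have "?C * (K * norm A) ^ k \<le> ?C * (K * R) ^ k"
          using K(1) AB by (intro mult_left_mono power_mono) auto
        thus "norm (mpow A k) \<le> ?C * (K * R) ^ k" using K(3)[of A k] by linarith
      qed (use K(1) R in auto)
      finally show ?case by (simp add: algebra_simps)
    qed simp
    also have "\<dots> \<le> ?C * (2 ^ k * (K * R) ^ k)"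
      using K(1) R of_nat_less_two_power[of k, where 'a=real]
      by (intro mult_left_mono mult_right_mono) auto
    finally show ?thesis by (simp add: power_mult_distrib)
  qed
  thus ?thesis by (rule that)
qed

text \<open>The exponential series is differentiated term by term; the Weierstrass test makes the
  series of derivatives converge uniformly for \<open>\<bar>s\<bar> < 1\<close>.\<close>

lemma has_vector_derivative_mexp:
  fixes A B :: "'n::finite cmat"
  shows "(\<lambda>k. (1 / fact k) *\<^sub>R dpow A B k) sums dexp A B"
    and "((\<lambda>s. mexp (A + s *\<^sub>R B)) has_vector_derivative dexp A B) (at 0)"
proof -
  obtain K where K: "\<And>(A :: 'n cmat) B R k. norm A \<le> R \<Longrightarrow> norm B \<le> R \<Longrightarrow>
       norm (dpow A B k) \<le> norm (mat 1 :: 'n cmat) * (2 * (K * R)) ^ k"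
    using norm_dpow_le[where 'n='n] by metis
  define R where "R = norm A + norm B"
  define S where "S = {-1 <..< 1 :: real}"
  let ?d = "\<lambda>k s. (1 / fact k) *\<^sub>R dpow (A + s *\<^sub>R B) B k"
  let ?M = "\<lambda>k. norm (mat 1 :: 'n cmat) * ((2 * (K * R)) ^ k / fact k)"
  have bound: "norm (?d k s) \<le> ?M k" if "s \<in> S" for k s
  proof -
    have "norm (A + s *\<^sub>R B) \<le> norm A + \<bar>s\<bar> * norm B"
      using norm_triangle_ineq[of A "s *\<^sub>R B"] by simp
    also have "\<bar>s\<bar> * norm B \<le> 1 * norm B"
      using that by (intro mult_right_mono) (auto simp: S_def)
    finally have "norm (A + s *\<^sub>R B) \<le> R" by (simp add: R_def)
    moreover have "norm B \<le> R" by (simp add: R_def)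
    ultimately have "norm (dpow (A + s *\<^sub>R B) B k) \<le> norm (mat 1 :: 'n cmat) * (2 * (K * R)) ^ k"
      by (rule K)
    thus ?thesis by (simp add: divide_right_mono)
  qed
  have "summable (\<lambda>k. ?d k 0)"
    by (rule summable_comparison_test'[OF summable_power_over_fact bound]) (simp add: S_def)
  thus "(\<lambda>k. (1 / fact k) *\<^sub>R dpow A B k) sums dexp A B"
    by (simp add: summable_sums dexp_def)
  have "uniform_limit S (\<lambda>n s. \<Sum>k<n. ?d k s) (\<lambda>s. dexp (A + s *\<^sub>R B) B) sequentially"
    unfolding dexp_def by (rule Weierstrass_m_test[OF bound summable_power_over_fact])
  hence unif: "\<forall>\<^sub>F n in sequentially. \<forall>s\<in>S. norm ((\<Sum>k<n. ?d k s) - dexp (A + s *\<^sub>R B) B) < e" if "e > 0" for e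
    using that unfolding uniform_limit_iff dist_norm by blast
  have "\<exists>g. \<forall>s\<in>S. (\<lambda>k. (1 / fact k) *\<^sub>R mpow (A + s *\<^sub>R B) k) sums g s \<and>
      (g has_derivative (\<lambda>h. h *\<^sub>R dexp (A + s *\<^sub>R B) B)) (at s within S)"
  proof (rule has_derivative_series[where x = 0 and l = "mexp (A + 0 *\<^sub>R B)"
        and f = "\<lambda>k s. (1 / fact k) *\<^sub>R mpow (A + s *\<^sub>R B) k" and f' = "\<lambda>k s h. h *\<^sub>R ?d k s"])
    show "((\<lambda>s. (1 / fact k) *\<^sub>R mpow (A + s *\<^sub>R B) k) has_derivative (\<lambda>h. h *\<^sub>R ?d k s)) (at s within S)" for k s
      using has_vector_derivative_scaleR[OF DERIV_const has_vector_derivative_mpow[of A B k s S], of "1 / fact k"]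
      by (simp add: has_vector_derivative_def)
    show "(\<lambda>k. (1 / fact k) *\<^sub>R mpow (A + 0 *\<^sub>R B) k) sums mexp (A + 0 *\<^sub>R B)" by (rule sums_mexp)
    fix e :: real assume "e > 0"
    show "\<forall>\<^sub>F n in sequentially. \<forall>s\<in>S. \<forall>h. norm ((\<Sum>k<n. h *\<^sub>R ?d k s) - h *\<^sub>R dexp (A + s *\<^sub>R B) B) \<le> e * norm h"
    proof (rule eventually_mono[OF unif[OF \<open>e > 0\<close>]], intro ballI allI)
      fix n s and h :: real
      assume *: "\<forall>s\<in>S. norm ((\<Sum>k<n. ?d k s) - dexp (A + s *\<^sub>R B) B) < e" "s \<in> S"
      have "(\<Sum>k<n. h *\<^sub>R ?d k s) - h *\<^sub>R dexp (A + s *\<^sub>R B) B = h *\<^sub>R ((\<Sum>k<n. ?d k s) - dexp (A + s *\<^sub>R B) B)"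
        by (simp only: scaleR_diff_right scaleR_sum_right)
      hence "norm ((\<Sum>k<n. h *\<^sub>R ?d k s) - h *\<^sub>R dexp (A + s *\<^sub>R B) B) = \<bar>h\<bar> * norm ((\<Sum>k<n. ?d k s) - dexp (A + s *\<^sub>R B) B)"
        by simp
      also have "\<dots> \<le> \<bar>h\<bar> * e" using * by (intro mult_left_mono) (auto intro: less_imp_le)
      finally show "norm ((\<Sum>k<n. h *\<^sub>R ?d k s) - h *\<^sub>R dexp (A + s *\<^sub>R B) B) \<le> e * norm h"
        by (simp add: mult.commute)
    qed
  qed (auto simp: S_def)
  then obtain g where g: "\<And>s. s \<in> S \<Longrightarrow> (\<lambda>k. (1 / fact k) *\<^sub>R mpow (A + s *\<^sub>R B) k) sums g s"
     "\<And>s. s \<in> S \<Longrightarrow> (g has_derivative (\<lambda>h. h *\<^sub>R dexp (A + s *\<^sub>R B) B)) (at s within S)" by blast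
  have S0: "0 \<in> S" "open S" by (auto simp: S_def)
  \<comment> \<open>The differentiation theorem only yields some limit function \<open>g\<close>;
    uniqueness of sums identifies it with the exponential.\<close>
  have geq: "g s = mexp (A + s *\<^sub>R B)" if "s \<in> S" for s
    using sums_unique2[OF g(1)[OF that] sums_mexp] .
  have "(g has_derivative (\<lambda>h. h *\<^sub>R dexp A B)) (at 0)"
    using g(2)[OF S0(1)] at_within_open[OF S0] by simp
  hence "((\<lambda>s. mexp (A + s *\<^sub>R B)) has_derivative (\<lambda>h. h *\<^sub>R dexp A B)) (at 0)"
    by (rule has_derivative_transform_within_open[OF _ S0(2) S0(1) geq])
  thus "((\<lambda>s. mexp (A + s *\<^sub>R B)) has_vector_derivative dexp A B) (at 0)"
    by (simp add: has_vector_derivative_def)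
qed

text \<open>On the diagonal the quotient is replaced by its limit, the derivative of
  \<open>exp\<close>.\<close>

definition exp_divdiff :: "complex \<Rightarrow> complex \<Rightarrow> complex" where
  "exp_divdiff a b = (if a = b then exp a else (exp a - exp b) / (a - b))"

text \<open>Between a left eigenmatrix for \<open>a\<close> and a right one for \<open>b\<close>,
  the recursion of \<open>dpow\<close> becomes a scalar recursion solved by divided differences of
  powers; summing the series gives that of \<open>exp\<close>.\<close>

lemma dexp_eigen:
  fixes A B P Q :: "'n::finite cmat"
  assumes P: "P ** A = cscale a P" and Q: "A ** Q = cscale b Q"
  shows "P ** dexp A B ** Q = cscale (exp_divdiff a b) (P ** B ** Q)"
proof (rule sums_unique2)
  \<comment> \<open>The divided difference of the \<open>k\<close>-th power at \<open>a\<close> and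
    \<open>b\<close>. For \<open>k = 0\<close> the truncated exponent \<open>k - 1\<close> is
    harmless, since its factor is 0.\<close>
  define d where "d = (\<lambda>k. if a = b then of_nat k * a ^ (k - 1) else (a ^ k - b ^ k) / (a - b))"
  have d_Suc: "d (Suc k) = b ^ k + a * d k" for k
    by (cases k) (auto simp: d_def field_simps)
  have powQ: "mpow A k ** Q = cscale (b ^ k) Q" for k
    by (induction k) (auto simp: matrix_mul_assoc[symmetric] cscale_mult_right Q cscale_cscale mult.commute)
  have dpow: "P ** dpow A B k ** Q = cscale (d k) (P ** B ** Q)" for k
  proof (induction k)
    case 0
    show ?case by (simp add: d_def cscale.zero_left)
  next
    case (Suc k)
    have "P ** dpow A B (Suc k) ** Q = P ** B ** (mpow A k ** Q) + (P ** A) ** dpow A B k ** Q"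
      by (simp add: matrix_mult.add_right matrix_mult.add_left matrix_mul_assoc)
    also have "\<dots> = cscale (b ^ k) (P ** B ** Q) + cscale a (P ** dpow A B k ** Q)"
      by (simp add: powQ P cscale_mult_left cscale_mult_right)
    finally show ?case by (simp add: Suc d_Suc cscale.add_left cscale_cscale)
  qed
  have "(\<lambda>k. P ** ((1 / fact k) *\<^sub>R dpow A B k) ** Q) sums (P ** dexp A B ** Q)"
    by (intro bounded_linear.sums[OF matrix_mult.bounded_linear_left] bounded_linear.sums[OF matrix_mult.bounded_linear_right]
        has_vector_derivative_mexp)
  thus "(\<lambda>k. cscale (d k /\<^sub>R fact k) (P ** B ** Q)) sums (P ** dexp A B ** Q)"
    by (simp add: matrix_mult.scaleR_left matrix_mult.scaleR_right dpow cscale.scaleR_left divide_inverse)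
  have "(\<lambda>k. d k /\<^sub>R fact k) sums exp_divdiff a b"
  proof (cases "a = b")
    case True
    \<comment> \<open>The term of index 0 vanishes, and the shifted series is the exponential series
      itself.\<close>
    have "(\<lambda>k. d (Suc k) /\<^sub>R fact (Suc k)) = (\<lambda>k. a ^ k /\<^sub>R fact k)"
      using True by (simp add: d_def fun_eq_iff scaleR_conv_of_real field_simps del: of_nat_Suc)
    hence "(\<lambda>k. d (Suc k) /\<^sub>R fact (Suc k)) sums exp a"
      using exp_converges[of a] by simp
    thus ?thesis using True sums_Suc_iff[of "\<lambda>k. d k /\<^sub>R fact k"]
      by (simp only: exp_divdiff_def) (simp add: d_def del: fact_Suc)
  next
    case False
    have "(\<lambda>k. (a ^ k /\<^sub>R fact k - b ^ k /\<^sub>R fact k) / (a - b)) sums ((exp a - exp b) / (a - b))"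
      by (intro sums_divide sums_diff exp_converges)
    thus ?thesis using False by (simp add: d_def exp_divdiff_def scaleR_conv_of_real right_diff_distrib)
  qed
  thus "(\<lambda>k. cscale (d k /\<^sub>R fact k) (P ** B ** Q)) sums cscale (exp_divdiff a b) (P ** B ** Q)"
    by (rule bounded_linear.sums[OF cscale.bounded_linear_left])
qed

section \<open>Gibbs states\<close>

lemma hermitian_Gen:
  assumes "\<And>i. hermitian (G i)"
  shows "hermitian (Gen G \<theta>)"
  using assms unfolding hermitian_def Gen_def
  by (simp add: linear_sum[OF bounded_linear.linear[OF bounded_linear_adjoint]] linear_simps(5)[OF bounded_linear_adjoint])

text \<open>\<open>mexp H\<close> is the square of the Hermitian matrix
  \<open>mexp ((1 / 2) *\<^sub>R H)\<close>, which splits evenly between the two outer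
  factors.\<close>

lemma mexp_frob_decomposition:
  assumes "hermitian H"
  shows "mtrace (P ** mexp H ** adjoint P) = of_real (frob (mexp ((1 / 2) *\<^sub>R H) ** adjoint P))"
proof -
  let ?M = "mexp ((1 / 2) *\<^sub>R H)"
  have "mexp ((1 / 2) *\<^sub>R H + (1 / 2) *\<^sub>R H) = ?M ** ?M" by (rule mexp_add) simp
  also have "(1 / 2) *\<^sub>R H + (1 / 2) *\<^sub>R H = H" by (simp flip: scaleR_add_left)
  finally have "mexp H = ?M ** ?M" .
  moreover have "adjoint ?M = ?M"
    using assms by (simp add: adjoint_mexp hermitian_def linear_simps(5)[OF bounded_linear_adjoint])
  ultimately have "P ** mexp H ** adjoint P = adjoint (?M ** adjoint P) ** (?M ** adjoint P)"
    by (simp add: adjoint_mult matrix_mul_assoc)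
  thus ?thesis by (simp add: mtrace_adjoint_mult)
qed

lemma mexp_cancel:
  assumes "mexp A ** X = 0"
  shows "X = 0"
proof -
  have "mexp (- A) ** (mexp A ** X) = X"
    using mexp_mult_mexp_uminus[of "- A"] by (simp add: matrix_mul_assoc)
  thus ?thesis using assms by simp
qed

text \<open>The decomposition with \<open>P = mat 1\<close>; strict positivity holds because an
  exponential is invertible. Hence the partition function may be divided by.\<close>

lemma mtrace_mexp_pos:
  fixes H :: "'n::finite cmat"
  assumes "hermitian H"
  obtains z where "z > 0" "mtrace (mexp H) = of_real z"
proof
  show "mtrace (mexp H) = of_real (frob (mexp ((1 / 2) *\<^sub>R H)))"
    using mexp_frob_decomposition[OF assms, of "mat 1"] by simp
  have "mexp ((1 / 2) *\<^sub>R H) \<noteq> 0"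
  proof
    assume "mexp ((1 / 2) *\<^sub>R H) = 0"
    hence "mat 1 = (0 :: 'n cmat)" using mexp_cancel[of "(1 / 2) *\<^sub>R H" "mat 1"] by simp
    hence "(mat 1 :: 'n cmat) $ i $ i = 0" for i by simp
    thus False by (simp add: mat_def)
  qed
  thus "frob (mexp ((1 / 2) *\<^sub>R H)) > 0"
    using frob_nonneg[of "mexp ((1 / 2) *\<^sub>R H)"] frob_eq_0_iff[of "mexp ((1 / 2) *\<^sub>R H)"] by linarith
qed

text \<open>The trace of \<open>adjoint P ** (mexp H ** P)\<close> is both \<open>r * frob P\<close>
  and the squared norm of a nonzero matrix. This makes the logarithm of an eigenvalue
  meaningful.\<close>

lemma mexp_eigenvalue_pos:
  assumes H: "hermitian H" and P: "hermitian P" "P \<noteq> 0" and eig: "mexp H ** P = r *\<^sub>R P"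
  shows "r > 0"
proof -
  let ?M = "mexp ((1 / 2) *\<^sub>R H)"
  have "?M ** P \<noteq> 0" using mexp_cancel P(2) by blast
  hence "frob (?M ** P) > 0"
    using frob_nonneg[of "?M ** P"] frob_eq_0_iff[of "?M ** P"] by linarith
  also have "complex_of_real (frob (?M ** P)) = mtrace (adjoint P ** (mexp H ** P))"
    using mexp_frob_decomposition[OF H, of P] P(1) by (simp add: hermitian_def matrix_mul_assoc)
  hence "frob (?M ** P) = r * frob P"
    unfolding eig matrix_mult.scaleR_right linear_simps(5)[OF bounded_linear_mtrace] mtrace_adjoint_mult
    by (simp add: scaleR_conv_of_real flip: of_real_mult)
  finally show ?thesis using frob_nonneg[of P] by (simp add: zero_less_mult_iff)
qed

text \<open>The given spectral data belong to the state, whereas \<open>Phi\<close> is built from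
  \<open>Gen G \<theta>\<close>. Each projection is an eigenmatrix of the exponential with positive
  eigenvalue \<open>z * lam k\<close>, and \<open>hermitian_mexp_eigen\<close> takes the logarithm.
  Eigenvalues may be degenerate.\<close>

lemma gibbs_eigenprojection:
  assumes herm: "\<And>i. hermitian (G i)" and U: "unitary U"
    and spec: "gibbs G \<theta> = (\<Sum>k\<in>UNIV. lam k *\<^sub>R colproj U k)"
    and z: "z > 0" "mtrace (mexp (- Gen G \<theta>)) = of_real z"
  obtains \<mu> where "\<And>k. lam k = exp (- \<mu> k) / z"
    "\<And>k. Gen G \<theta> ** colproj U k = \<mu> k *\<^sub>R colproj U k"
proof
  let ?H = "- Gen G \<theta>"
  have H: "hermitian ?H"
    using hermitian_Gen[OF herm] by (simp add: hermitian_def linear_simps(4)[OF bounded_linear_adjoint])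
  have gibbs: "gibbs G \<theta> = (1 / z) *\<^sub>R mexp ?H"
    unfolding gibbs_def z(2) by (simp flip: cscale_of_real)
  have "gibbs G \<theta> ** colproj U k = lam k *\<^sub>R colproj U k" for k
    unfolding spec by (simp add: matrix_mult.sum_left matrix_mult.scaleR_left colproj_mult[OF U] if_distrib cong: if_cong)
  hence rescaled: "z *\<^sub>R ((1 / z) *\<^sub>R (mexp ?H ** colproj U k)) = z *\<^sub>R (lam k *\<^sub>R colproj U k)" for k
    by (simp only: gibbs matrix_mult.scaleR_left)
  have eig: "mexp ?H ** colproj U k = (z * lam k) *\<^sub>R colproj U k" for k
    using rescaled[of k] z(1) by simp
  have pos: "z * lam k > 0" for k
    by (rule mexp_eigenvalue_pos[OF H hermitian_colproj colproj_nonzero[OF U] eig])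
  show "lam k = exp (- (- ln (z * lam k))) / z" for k using pos[of k] z(1) by simp
  show "Gen G \<theta> ** colproj U k = (- ln (z * lam k)) *\<^sub>R colproj U k" for k
    using hermitian_mexp_eigen[OF H hermitian_colproj pos[of k] eig[of k]]
    by (metis matrix_mult.minus_left minus_minus scaleR_minus_left)
qed

section \<open>Matching the blocks of the channel with those of the derivative\<close>

lemma tent_transform_minus: "tent_transform (- w) = tent_transform w"
  by (simp add: tent_transform_def)

text \<open>Cancelling \<open>exp ((a + b) / 2)\<close> from difference and sum of the exponentials
  leaves a \<open>tanh\<close>. Here the weights of the SLD meet the Fourier transform.\<close>

lemma exp_divdiff_tent_transform:
  fixes a b :: real
  shows "2 / (exp a + exp b) * Re (exp_divdiff (of_real a) (of_real b)) = tent_transform (a - b)"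
proof (cases "a = b")
  case True
  thus ?thesis by (simp add: exp_divdiff_def tent_transform_def exp_of_real)
next
  case False
  have "exp a + exp b \<noteq> 0" using exp_gt_zero[of a] exp_gt_zero[of b] by linarith
  have "tanh ((a - b) / 2) = (exp a - exp b) / (exp a + exp b)"
  proof -
    have "exp a = exp ((a - b) / 2) * exp ((a + b) / 2)" "exp b = exp (- ((a - b) / 2)) * exp ((a + b) / 2)"
      by (simp_all add: field_simps flip: exp_add)
    hence "(exp a - exp b) / (exp a + exp b) =
       ((exp ((a - b) / 2) - exp (- ((a - b) / 2))) * exp ((a + b) / 2)) /
       ((exp ((a - b) / 2) + exp (- ((a - b) / 2))) * exp ((a + b) / 2))"
      by (simp add: algebra_simps)
    thus ?thesis by (simp add: tanh_altdef)
  qed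
  moreover have "exp_divdiff (of_real a) (of_real b) = of_real ((exp a - exp b) / (a - b))"
    using False by (simp add: exp_divdiff_def exp_of_real)
  hence "Re (exp_divdiff (of_real a) (of_real b)) = (exp a - exp b) / (a - b)"
    by (simp only: Re_complex_of_real)
  ultimately show ?thesis using False by (simp add: tent_transform_def)
qed

lemma exp_divdiff_of_real: "exp_divdiff (of_real a) (of_real b) = of_real (Re (exp_divdiff (of_real a) (of_real b)))"
  by (simp add: exp_divdiff_def exp_of_real flip: of_real_diff of_real_divide)

text \<open>Conjugation by the unitary group multiplies the block \<open>(k, l)\<close> by a phase
  of frequency \<open>\<mu> l - \<mu> k\<close>. Averaging over \<open>t\<close> replaces the phase
  by the Fourier transform of the density, which is even.\<close>

lemma Phi_eq:
  fixes G :: "'J::finite \<Rightarrow> 'n::finite cmat"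
  assumes U: "unitary U" and H: "hermitian (Gen G \<theta>)"
    and eig: "\<And>k. Gen G \<theta> ** colproj U k = \<mu> k *\<^sub>R colproj U k"
  shows "Phi G \<theta> X = (\<Sum>k\<in>UNIV. \<Sum>l\<in>UNIV. tent_transform (\<mu> k - \<mu> l) *\<^sub>R (colproj U k ** X ** colproj U l))"
proof -
  let ?P = "colproj U"
  have eig_left: "?P k ** Gen G \<theta> = \<mu> k *\<^sub>R ?P k" for k
    by (rule hermitian_eigen_left[OF H hermitian_colproj eig])
  have left: "?P k ** mexp (cscale c (Gen G \<theta>)) = cscale (exp (c * of_real (\<mu> k))) (?P k)" for c k
    by (rule mexp_eigen_left) (simp add: cscale_mult_right eig_left cscale_cscale flip: cscale_of_real)
  have right: "mexp (cscale c (Gen G \<theta>)) ** ?P k = cscale (exp (c * of_real (\<mu> k))) (?P k)" for c k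
    by (rule mexp_eigen_right) (simp add: cscale_mult_left eig cscale_cscale flip: cscale_of_real)
  define w where "w = (\<lambda>k l t. of_real (tent t) * exp (\<i> * of_real ((\<mu> l - \<mu> k) * t)))"
  have "tent t *\<^sub>R (mexp (cscale (- \<i> * complex_of_real t) (Gen G \<theta>)) ** X **
       mexp (cscale (\<i> * complex_of_real t) (Gen G \<theta>)))
     = (\<Sum>k\<in>UNIV. \<Sum>l\<in>UNIV. cscale (w k l t) (?P k ** X ** ?P l))" (is "tent t *\<^sub>R (?V ** X ** ?W) = _") for t
  proof -
    have "?P k ** (?V ** X ** ?W) ** ?P l =
       cscale (exp (- \<i> * of_real t * of_real (\<mu> k)) * exp (\<i> * of_real t * of_real (\<mu> l))) (?P k ** X ** ?P l)" for k l
    proof -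
      have "?P k ** (?V ** X ** ?W) ** ?P l = (?P k ** ?V) ** X ** (?W ** ?P l)"
        by (simp only: matrix_mul_assoc)
      thus ?thesis by (simp only: left right cscale_mult_left cscale_mult_right cscale_cscale mult.commute)
    qed
    moreover have "of_real (tent t) * (exp (- \<i> * of_real t * of_real (\<mu> k)) * exp (\<i> * of_real t * of_real (\<mu> l))) = w k l t" for k l
      by (simp add: w_def algebra_simps flip: exp_add)
    ultimately have "tent t *\<^sub>R (?P k ** (?V ** X ** ?W) ** ?P l) = cscale (w k l t) (?P k ** X ** ?P l)" for k l
      by (simp only: cscale_of_real[symmetric] cscale_cscale)
    thus ?thesis
      by (subst block_decomposition[OF U, of "?V ** X ** ?W"]) (simp only: scaleR_sum_right)
  qed
  moreover have "has_bochner_integral lborel (\<lambda>t. \<Sum>k\<in>UNIV. \<Sum>l\<in>UNIV. cscale (w k l t) (?P k ** X ** ?P l))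
     (\<Sum>k\<in>UNIV. \<Sum>l\<in>UNIV. cscale (of_real (tent_transform (\<mu> l - \<mu> k))) (?P k ** X ** ?P l))"
    unfolding w_def
    by (intro has_bochner_integral_sum has_bochner_integral_bounded_linear[OF cscale.bounded_linear_left]
        has_bochner_integral_tent_exp)
  moreover have "tent_transform (\<mu> l - \<mu> k) = tent_transform (\<mu> k - \<mu> l)" for k l
    using tent_transform_minus[of "\<mu> k - \<mu> l"] by simp
  ultimately show ?thesis
    unfolding Phi_def by (simp add: has_bochner_integral_iff cscale_of_real)
qed

text \<open>Only diagonal blocks contribute to a trace, and on them the divided difference is
  \<open>exp (a k)\<close>. This gives the derivative of the partition function although
  \<open>H\<close> and \<open>X\<close> need not commute.\<close>

lemma mtrace_dexp:
  fixes H X :: "'n::finite cmat"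
  assumes U: "unitary U" and right: "\<And>k. H ** colproj U k = cscale (a k) (colproj U k)"
    and left: "\<And>k. colproj U k ** H = cscale (a k) (colproj U k)"
  shows "mtrace (dexp H X) = mtrace (X ** mexp H)"
proof -
  let ?P = "colproj U"
  \<comment> \<open>Cyclicity of the trace together with idempotence of the projections.\<close>
  have tr: "mtrace Y = (\<Sum>k\<in>UNIV. mtrace (?P k ** Y ** ?P k))" for Y
  proof -
    have "mtrace (?P k ** Y ** ?P k) = mtrace (?P k ** Y)" for k
      using mtrace_commute[of "?P k ** Y" "?P k"] by (simp add: matrix_mul_assoc colproj_mult[OF U])
    moreover have "mtrace Y = mtrace ((\<Sum>k\<in>UNIV. ?P k) ** Y)" by (simp add: sum_colproj[OF U])
    ultimately show ?thesis by (simp add: matrix_mult.sum_left linear_sum[OF bounded_linear.linear[OF bounded_linear_mtrace]])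
  qed
  have "?P k ** (X ** mexp H) ** ?P k = cscale (exp (a k)) (?P k ** X ** ?P k)" for k
    by (simp add: matrix_mul_assoc[symmetric] mexp_eigen_right[OF right] cscale_mult_right)
  moreover have "?P k ** dexp H X ** ?P k = cscale (exp (a k)) (?P k ** X ** ?P k)" for k
    by (simp add: dexp_eigen[OF left right] exp_divdiff_def)
  ultimately show ?thesis using tr[of "dexp H X"] tr[of "X ** mexp H"] by simp
qed

text \<open>The quotient rule. Along the \<open>j\<close>-th axis the exponent moves in direction
  \<open>- G j\<close>, and the derivative of the normalisation contributes the expectation of
  \<open>G j\<close> times the state.\<close>

lemma pderiv_gibbs:
  fixes G :: "'J::finite \<Rightarrow> 'n::finite cmat"
  assumes "mtrace (mexp (- Gen G \<theta>)) \<noteq> 0"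
    and tr: "mtrace (dexp (- Gen G \<theta>) (- G j)) = - mtrace (G j ** mexp (- Gen G \<theta>))"
  shows "pderiv_j (gibbs G) \<theta> j = cscale (1 / mtrace (mexp (- Gen G \<theta>))) (dexp (- Gen G \<theta>) (- G j))
      + cscale (mtrace (G j ** gibbs G \<theta>)) (gibbs G \<theta>)"
proof -
  let ?H = "- Gen G \<theta>"
  define E where "E = (\<lambda>s. mexp (?H + s *\<^sub>R (- G j)))"
  define D where "D = dexp ?H (- G j)"
  define Z where "Z = mtrace (mexp ?H)"
  have Z0: "mtrace (E 0) = Z" by (simp add: E_def Z_def)
  have Gen: "Gen G (\<theta> + s *\<^sub>R axis j 1) = Gen G \<theta> + s *\<^sub>R G j" for s
  proof -
    have "Gen G (\<theta> + s *\<^sub>R axis j 1) = Gen G \<theta> + (\<Sum>i\<in>UNIV. (s * axis j 1 $ i) *\<^sub>R G i)"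
      by (simp add: Gen_def scaleR_add_left sum.distrib)
    also have "(\<Sum>i\<in>UNIV. (s * axis j 1 $ i) *\<^sub>R G i) = (\<Sum>i\<in>UNIV. if i = j then s *\<^sub>R G i else 0)"
      by (intro sum.cong) (auto simp: axis_def)
    finally show ?thesis by simp
  qed
  have gibbs: "gibbs G (\<theta> + s *\<^sub>R axis j 1) = cscale (inverse (mtrace (E s))) (E s)" for s
    unfolding gibbs_def Gen E_def by (simp add: inverse_eq_divide)
  have dE: "(E has_vector_derivative D) (at 0)"
    unfolding E_def D_def by (rule has_vector_derivative_mexp)
  have dZ: "((\<lambda>s. mtrace (E s)) has_derivative (\<lambda>h. h *\<^sub>R mtrace D)) (at 0)"
    using bounded_linear.has_vector_derivative[OF bounded_linear_mtrace dE]
    by (simp add: has_vector_derivative_def)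
  have "((\<lambda>s. inverse (mtrace (E s))) has_derivative (\<lambda>h. - (inverse (mtrace (E 0)) * (h *\<^sub>R mtrace D) * inverse (mtrace (E 0))))) (at 0)"
    by (rule Deriv.has_derivative_inverse[OF _ dZ]) (use assms(1) in \<open>simp add: Z0 Z_def\<close>)
  hence "((\<lambda>s. inverse (mtrace (E s))) has_vector_derivative (- mtrace D / Z\<^sup>2)) (at 0)"
    unfolding has_vector_derivative_def Z0
    by (rule has_derivative_eq_rhs) (simp add: fun_eq_iff power2_eq_square divide_inverse scaleR_conv_of_real)
  from cscale.has_vector_derivative[OF this dE]
  have "((\<lambda>s. gibbs G (\<theta> + s *\<^sub>R axis j 1)) has_vector_derivative
       (cscale (inverse (mtrace (E 0))) D + cscale (- mtrace D / Z\<^sup>2) (E 0))) (at 0)"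
    by (simp add: gibbs)
  hence "pderiv_j (gibbs G) \<theta> j = cscale (1 / Z) D + cscale (- mtrace D / Z\<^sup>2) (E 0)"
    unfolding pderiv_j_def Z0 by (simp add: vector_derivative_at inverse_eq_divide)
  \<comment> \<open>One factor \<open>1 / Z\<close> goes into each of the two occurrences of the
    state.\<close>
  also have "cscale (- mtrace D / Z\<^sup>2) (E 0) = cscale (mtrace (G j ** gibbs G \<theta>)) (gibbs G \<theta>)"
    using tr by (simp add: gibbs_def cscale_mult_right mtrace_cscale cscale_cscale D_def E_def Z_def
        power2_eq_square)
  finally show ?thesis by (simp add: Z_def D_def)
qed

text \<open>The SLD refers to a spectral decomposition, so the claim is made for every choice of
  \<open>U\<close> and \<open>lam\<close>, including every basis inside a degenerate eigenspace.
  Positivity of \<open>lam\<close> is derived from the form of the state.\<close>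

theorem theorem3:
  fixes G :: "'J::finite \<Rightarrow> complex^'n::finite^'n"
    and \<theta> :: "real^'J" and j :: 'J
    and U :: "complex^'n^'n" and lam :: "'n \<Rightarrow> real"
  assumes herm: "\<And>i. hermitian (G i)"
    and U: "unitary U"
    and spec: "gibbs G \<theta> = (\<Sum>k\<in>UNIV. lam k *\<^sub>R colproj U k)"
  shows "sld U lam (pderiv_j (gibbs G) \<theta> j)
         = - Phi G \<theta> (G j) + mat (mtrace (G j ** gibbs G \<theta>))"
proof -
  let ?H = "- Gen G \<theta>" and ?P = "colproj U"
  have H: "hermitian (Gen G \<theta>)" by (rule hermitian_Gen[OF herm])
  hence H': "hermitian ?H" by (simp add: hermitian_def linear_simps(4)[OF bounded_linear_adjoint])
  obtain z where z: "z > 0" "mtrace (mexp ?H) = of_real z" by (rule mtrace_mexp_pos[OF H'])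
  obtain \<mu> where lam: "\<And>k. lam k = exp (- \<mu> k) / z"
    and eig: "\<And>k. Gen G \<theta> ** ?P k = \<mu> k *\<^sub>R ?P k"
    by (rule gibbs_eigenprojection[OF herm U spec z]) blast
  have eig_left: "?P k ** Gen G \<theta> = \<mu> k *\<^sub>R ?P k" for k
    by (rule hermitian_eigen_left[OF H hermitian_colproj eig])
  have right: "?H ** ?P k = cscale (of_real (- \<mu> k)) (?P k)" for k
    unfolding cscale_of_real by (simp add: matrix_mult.minus_left eig)
  have left: "?P k ** ?H = cscale (of_real (- \<mu> k)) (?P k)" for k
    unfolding cscale_of_real by (simp add: matrix_mult.minus_right eig_left)
  define \<tau> where "\<tau> = mtrace (G j ** gibbs G \<theta>)"
  define D where "D = dexp ?H (- G j)"
  have tr: "mtrace D = - mtrace (G j ** mexp ?H)"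
    unfolding D_def mtrace_dexp[OF U right left] matrix_mult.minus_left
    by (rule linear_simps(4)[OF bounded_linear_mtrace])
  have rho': "pderiv_j (gibbs G) \<theta> j = (1 / z) *\<^sub>R D + cscale \<tau> (gibbs G \<theta>)"
    using pderiv_gibbs[OF _ tr[unfolded D_def]] z
    by (simp add: \<tau>_def D_def flip: cscale_of_real)
  \<comment> \<open>The part with \<open>D\<close> gives a block of the channel. The part
    proportional to the state survives only for \<open>k = l\<close>, where the weight
    \<open>2 / (lam k + lam k)\<close> cancels its eigenvalue.\<close>
  have block: "(2 / (lam k + lam l)) *\<^sub>R (?P k ** pderiv_j (gibbs G) \<theta> j ** ?P l) =
      - (tent_transform (\<mu> k - \<mu> l) *\<^sub>R (?P k ** G j ** ?P l)) + (if k = l then cscale \<tau> (?P k) else 0)" for k l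
  proof -
    let ?d = "Re (exp_divdiff (of_real (- \<mu> k)) (of_real (- \<mu> l)))"
    have e: "2 / (lam k + lam l) * (1 / z) * ?d = tent_transform (\<mu> k - \<mu> l)"
    proof -
      \<comment> \<open>The normalisation in \<open>lam\<close> cancels the factor
        \<open>1 / z\<close> of the derivative.\<close>
      have "2 / (lam k + lam l) * (1 / z) = 2 / (exp (- \<mu> k) + exp (- \<mu> l))"
        using z(1) by (simp add: lam field_simps)
      hence "2 / (lam k + lam l) * (1 / z) * ?d = tent_transform (- \<mu> k - - \<mu> l)"
        by (simp only: exp_divdiff_tent_transform)
      also have "\<dots> = tent_transform (\<mu> k - \<mu> l)"
        using tent_transform_minus[of "\<mu> k - \<mu> l"] by simp
      finally show ?thesis .
    qed
    have "?P k ** D ** ?P l = ?d *\<^sub>R - (?P k ** G j ** ?P l)"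
      unfolding D_def dexp_eigen[OF left right]
      by (subst exp_divdiff_of_real) (simp add: cscale_of_real matrix_mult.minus_left matrix_mult.minus_right)
    hence "(2 / (lam k + lam l)) *\<^sub>R (?P k ** ((1 / z) *\<^sub>R D) ** ?P l) =
        - (tent_transform (\<mu> k - \<mu> l) *\<^sub>R (?P k ** G j ** ?P l))"
      unfolding e[symmetric] by (simp add: matrix_mult.scaleR_left matrix_mult.scaleR_right)
    moreover have "(2 / (lam k + lam l)) *\<^sub>R (?P k ** cscale \<tau> (gibbs G \<theta>) ** ?P l) =
        (if k = l then cscale \<tau> (?P k) else 0)"
    proof -
      have "gibbs G \<theta> ** ?P l = lam l *\<^sub>R ?P l"
        unfolding spec by (simp add: matrix_mult.sum_left matrix_mult.scaleR_left colproj_mult[OF U] if_distrib cong: if_cong)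
      hence "?P k ** cscale \<tau> (gibbs G \<theta>) ** ?P l = lam l *\<^sub>R cscale \<tau> (?P k ** ?P l)"
        by (simp add: cscale_mult_left cscale_mult_right matrix_mul_assoc[symmetric] matrix_mult.scaleR_right
            cscale.scaleR_right)
      \<comment> \<open>Positivity makes the division by \<open>lam l + lam l\<close>
        genuine.\<close>
      moreover have "lam l > 0" using z(1) by (simp add: lam)
      ultimately show ?thesis by (simp add: colproj_mult[OF U] cscale.zero_right)
    qed
    ultimately show ?thesis
      unfolding rho' matrix_mult.add_right matrix_mult.add_left scaleR_add_right by simp
  qed
  have "sld U lam (pderiv_j (gibbs G) \<theta> j) = - Phi G \<theta> (G j) + (\<Sum>k\<in>UNIV. cscale \<tau> (?P k))"
    unfolding sld_def block Phi_eq[OF U H eig] by (simp add: sum_subtractf)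
  also have "(\<Sum>k\<in>UNIV. cscale \<tau> (?P k)) = mat \<tau>"
    by (simp add: mat_eq_cscale[of \<tau>] sum_colproj[OF U] flip: cscale.sum_right)
  finally show ?thesis unfolding \<tau>_def .
qed

end
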